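(* Let $M$ be a geodesically complete connected oriented non-compact Riemannian $C^\infty$-manifold, let $\mu$ be a non-atomic Radon measure on $(M,\mathcal{B}(M))$ with $\mu(O)>0$ for every non-empty open $O\subset M$ and $\mu(M)=\infty$, and let $0<\alpha<1$. For each $\varphi\in\mathcal{D}(M)$, the following relations hold on $B_{bs}(\Gamma_0)$: $$a^-_\alpha(\varphi):=I_\alpha^{-1}a^-_\lambda(\varphi)I_\alpha=\sqrt{\frac{E_\alpha^{(|\cdot|+1)}(0)}{E_\alpha^{(|\cdot|)}(0)}}\;a^-_\lambda(\varphi)$$ and $$a^+_\alpha(\varphi):=I_\alpha^{-1}a^+_\lambda(\varphi)I_\alpha=\sqrt{\frac{E_\alpha^{(|\cdot|-1)}(0)}{E_\alpha^{(|\cdot|)}(0)}}\;a^+_\lambda(\varphi),$$ where the square-root factors act as multiplication by the indicated functions of $\eta\in\Gamma_0$ (in the second relation both sides are read as $0$ at $\eta=\emptyset$, where $a^+_\lambda(\varphi)G$ vanishes).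
   Context: $E_\alpha(z)=\sum_{n=0}^\infty \frac{z^n}{\Gamma(\alpha n+1)}$ is the Mittag-Leffler function ($\Gamma(\cdot)$ the Euler Gamma function), $E_\alpha^{(n)}$ is its $n$-th derivative, and $E_\alpha^{(|\cdot|)}(0)$ is the function $\eta\mapsto E_\alpha^{(|\eta|)}(0)$, where $|\eta|$ is the cardinality of $\eta$ (similarly with $|\cdot|\pm1$). $\mathcal{D}(M)$ is the space of compactly supported $C^\infty$-functions on $M$. $\mathcal{B}_c(M)$ is the family of Borel subsets of $M$ with compact closure. $\Gamma_0:=\bigsqcup_{n=0}^\infty\Gamma_M^{(n)}$ is the space of finite configurations, where for Borel $Y\subset M$, $\Gamma_Y^{(n)}$ is the set of $n$-point subsets of $Y$ and $\Gamma_Y^{(0)}=\{\emptyset\}$. With $\widetilde{M^n}:=\{(x_1,\dots,x_n)\in M^n:x_i\ne x_j\text{ if }i\neq j\}$ and $\mathrm{sym}_M^n:\widetilde{M^n}\to\Gamma_M^{(n)}$, $(x_1,\dots,x_n)\mapsto\{x_1,\dots,x_n\}$, the space $\Gamma_M^{(n)}$ is identified with $\widetilde{M^n}/S_n$ and carries the induced topology and Borel $\sigma$-algebra; $\Gamma_0$ carries the disjoint-union topology and its Borel $\sigma$-algebra $\mathcal{B}(\Gamma_0)$. Put $\mu^{(n)}:=\mu^{\otimes n}\circ(\mathrm{sym}_M^n)^{-1}$, with $\mu^{(0)}$ the unit mass at $\emptyset$, and define $\lambda_\mu:=\sum_{n=0}^\infty\frac{1}{n!}\mu^{(n)}$ and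 $\lambda_\mu^\alpha:=\sum_{n=0}^\infty\frac{1}{\Gamma(\alpha n+1)}\mu^{(n)}$ on $(\Gamma_0,\mathcal{B}(\Gamma_0))$. $I_\alpha:L^2(\lambda_\mu^\alpha)\to L^2(\lambda_\mu)$ is the unitary isomorphism $I_\alpha(G):=G\sqrt{E_\alpha^{(|\cdot|)}(0)}$. $B_{bs}(\Gamma_0)$ is the space of complex-valued bounded $\mathcal{B}(\Gamma_0)$-measurable functions $G$ with bounded support, i.e. $G$ vanishes outside $\bigsqcup_{n=0}^N\Gamma_\Lambda^{(n)}$ for some $N\in\mathbb{N}_0$ and $\Lambda\in\mathcal{B}_c(M)$. For $\varphi\in\mathcal{D}(M)$ and $G\in B_{bs}(\Gamma_0)$, the annihilation and creation operators on $L^2(\lambda_\mu)$ are $$(a_\lambda^-(\varphi)G)(\eta):=\int_M G(\eta\cup\{x\})\varphi(x)\,d\mu(x),\quad \eta\in\Gamma_0,$$ $$(a_\lambda^+(\varphi)G)(\eta):=\sum_{x\in\eta}G(\eta\setminus\{x\})\varphi(x),\quad \lambda_\mu\text{-a.a. }\eta\in\Gamma_0.$$ *)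

theory Defs
  imports "HOL-Analysis.Analysis"
begin

section \<open>Oriented Riemannian manifolds\<close>

text \<open>
  The underlying space is a whole type of class second countable Hausdorff; the dimension is the
  cardinality of the index type \<open>'n\<close>. The predicates on functions between Euclidean spaces are only
  meant for open sets \<open>S\<close>.
\<close>

primrec Ck_on :: "nat \<Rightarrow> ('e::euclidean_space \<Rightarrow> 'f::real_normed_vector) \<Rightarrow> 'e set \<Rightarrow> bool" where
  "Ck_on 0 f S \<longleftrightarrow> continuous_on S f"
| "Ck_on (Suc k) f S \<longleftrightarrow>
     f differentiable_on S \<and> (\<forall>v. Ck_on k (\<lambda>x. frechet_derivative f (at x) v) S)"

definition smooth_on :: "('e::euclidean_space \<Rightarrow> 'f::real_normed_vector) \<Rightarrow> 'e set \<Rightarrow> bool" where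
  "smooth_on f S \<longleftrightarrow> (\<forall>k. Ck_on k f S)"

type_synonym ('a, 'n) chart = "'a set \<times> ('a \<Rightarrow> real ^ 'n)"

abbreviation dom_of :: "('a, 'n) chart \<Rightarrow> 'a set" where
  "dom_of c \<equiv> fst c"

abbreviation coord :: "('a, 'n) chart \<Rightarrow> 'a \<Rightarrow> real ^ 'n" where
  "coord c \<equiv> snd c"

definition is_chart :: "('a::topological_space, 'n::finite) chart \<Rightarrow> bool" where
  "is_chart c \<longleftrightarrow> open (dom_of c) \<and> open (coord c ` dom_of c) \<and>
     (\<exists>h. homeomorphism (dom_of c) (coord c ` dom_of c) (coord c) h)"

definition transition :: "('a, 'n) chart \<Rightarrow> ('a, 'n) chart \<Rightarrow> real ^ 'n \<Rightarrow> real ^ 'n" where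
  "transition c d = coord d \<circ> inv_into (dom_of c) (coord c)"

definition jacobian :: "(real ^ 'n::finite \<Rightarrow> real ^ 'n) \<Rightarrow> real ^ 'n \<Rightarrow> real ^ 'n ^ 'n" where
  "jacobian f x = matrix (frechet_derivative f (at x))"

definition smooth_atlas ::
  "('a::{second_countable_topology, t2_space}, 'n::finite) chart set \<Rightarrow> bool" where
  "smooth_atlas A \<longleftrightarrow> (\<forall>c\<in>A. is_chart c) \<and> (\<Union>c\<in>A. dom_of c) = UNIV \<and>
     (\<forall>c\<in>A. \<forall>d\<in>A. smooth_on (transition c d) (coord c ` (dom_of c \<inter> dom_of d)))"

text \<open>An orientation is given by an atlas all of whose coordinate changes preserve orientation.\<close>

definition oriented_atlas ::
  "('a::{second_countable_topology, t2_space}, 'n::finite) chart set \<Rightarrow> bool" where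
  "oriented_atlas A \<longleftrightarrow> smooth_atlas A \<and>
     (\<forall>c\<in>A. \<forall>d\<in>A. \<forall>x \<in> coord c ` (dom_of c \<inter> dom_of d). det (jacobian (transition c d) x) > 0)"

text \<open>
  A Riemannian metric is given by its Gram matrices \<open>g c x\<close> in the coordinates of each chart \<open>c\<close>
  of the atlas, \<open>x\<close> being the coordinate vector; the last clause is the tensor transformation law.
\<close>

type_synonym ('a, 'n) metric = "('a, 'n) chart \<Rightarrow> real ^ 'n \<Rightarrow> real ^ 'n ^ 'n"

definition riemannian_metric ::
  "('a::{second_countable_topology, t2_space}, 'n::finite) chart set \<Rightarrow> ('a, 'n) metric \<Rightarrow> bool" where
  "riemannian_metric A g \<longleftrightarrow>
     (\<forall>c\<in>A. smooth_on (g c) (coord c ` dom_of c)) \<and>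
     (\<forall>c\<in>A. \<forall>x \<in> coord c ` dom_of c. transpose (g c x) = g c x) \<and>
     (\<forall>c\<in>A. \<forall>x \<in> coord c ` dom_of c. \<forall>v. v \<noteq> 0 \<longrightarrow> v \<bullet> (g c x *v v) > 0) \<and>
     (\<forall>c\<in>A. \<forall>d\<in>A. \<forall>x \<in> coord c ` (dom_of c \<inter> dom_of d).
        g c x = transpose (jacobian (transition c d) x) ** g d (transition c d x)
                  ** jacobian (transition c d) x)"

definition metric_partial ::
  "('a, 'n::finite) metric \<Rightarrow> ('a, 'n) chart \<Rightarrow> 'n \<Rightarrow> 'n \<Rightarrow> 'n \<Rightarrow> real ^ 'n \<Rightarrow> real" where
  "metric_partial g c i j l x = frechet_derivative (\<lambda>y. g c y $ j $ l) (at x) (axis i 1)"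

definition christoffel ::
  "('a, 'n::finite) metric \<Rightarrow> ('a, 'n) chart \<Rightarrow> 'n \<Rightarrow> 'n \<Rightarrow> 'n \<Rightarrow> real ^ 'n \<Rightarrow> real" where
  "christoffel g c k i j x = (\<Sum>l\<in>UNIV. matrix_inv (g c x) $ k $ l *
     (metric_partial g c i j l x + metric_partial g c j i l x - metric_partial g c l i j x)) / 2"

definition complete_geodesic ::
  "('a::{second_countable_topology, t2_space}, 'n::finite) chart set \<Rightarrow> ('a, 'n) metric
     \<Rightarrow> (real \<Rightarrow> 'a) \<Rightarrow> bool" where
  "complete_geodesic A g \<gamma> \<longleftrightarrow> continuous_on UNIV \<gamma> \<and>
     (\<forall>c\<in>A. \<exists>v. \<forall>t. \<gamma> t \<in> dom_of c \<longrightarrow>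
        ((coord c \<circ> \<gamma>) has_vector_derivative v t) (at t) \<and>
        (v has_vector_derivative
           (\<chi> k. - (\<Sum>i\<in>UNIV. \<Sum>j\<in>UNIV. christoffel g c k i j (coord c (\<gamma> t)) * v t $ i * v t $ j)))
          (at t))"

definition geodesically_complete ::
  "('a::{second_countable_topology, t2_space}, 'n::finite) chart set \<Rightarrow> ('a, 'n) metric \<Rightarrow> bool" where
  "geodesically_complete A g \<longleftrightarrow>
     (\<forall>c\<in>A. \<forall>p\<in>dom_of c. \<forall>v. \<exists>\<gamma>. complete_geodesic A g \<gamma> \<and> \<gamma> 0 = p \<and>
        ((coord c \<circ> \<gamma>) has_vector_derivative v) (at 0))"

definition smooth_function ::
  "('a::{second_countable_topology, t2_space}, 'n::finite) chart set
     \<Rightarrow> ('a \<Rightarrow> 'f::real_normed_vector) \<Rightarrow> bool" where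
  "smooth_function A f \<longleftrightarrow>
     (\<forall>c\<in>A. smooth_on (f \<circ> inv_into (dom_of c) (coord c)) (coord c ` dom_of c))"

text \<open>Smooth functions with compact support; complex values include the real-valued test functions.\<close>

definition test_functions ::
  "('a::{second_countable_topology, t2_space}, 'n::finite) chart set \<Rightarrow> ('a \<Rightarrow> complex) set" where
  "test_functions A = {\<phi>. smooth_function A \<phi> \<and> compact (closure {x. \<phi> x \<noteq> 0})}"


section \<open>Measures on the manifold\<close>

definition radon_measure :: "'a::topological_space measure \<Rightarrow> bool" where
  "radon_measure \<mu> \<longleftrightarrow> sets \<mu> = sets borel \<and>
     (\<forall>K. compact K \<longrightarrow> emeasure \<mu> K < \<infinity>) \<and>
     (\<forall>B\<in>sets borel. emeasure \<mu> B = (SUP K\<in>{K. compact K \<and> K \<subseteq> B}. emeasure \<mu> K))"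

definition non_atomic :: "'a measure \<Rightarrow> bool" where
  "non_atomic \<mu> \<longleftrightarrow> (\<forall>A\<in>sets \<mu>. emeasure \<mu> A > 0 \<longrightarrow>
     (\<exists>B\<in>sets \<mu>. B \<subseteq> A \<and> 0 < emeasure \<mu> B \<and> emeasure \<mu> B < emeasure \<mu> A))"


section \<open>Finite configurations\<close>

definition n_configs :: "'a set \<Rightarrow> nat \<Rightarrow> 'a set set" where
  "n_configs Y n = {\<eta>. \<eta> \<subseteq> Y \<and> finite \<eta> \<and> card \<eta> = n}"

definition finite_configs :: "'a set set" where
  "finite_configs = (\<Union>n. n_configs UNIV n)"

text \<open>\<open>M\<^sup>n\<close> is represented by the extensional functions on \<open>{..<n}\<close>.\<close>

definition off_diag :: "nat \<Rightarrow> (nat \<Rightarrow> 'a) set" where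
  "off_diag n = {x \<in> {..<n} \<rightarrow>\<^sub>E UNIV. inj_on x {..<n}}"

definition sym_map :: "nat \<Rightarrow> (nat \<Rightarrow> 'a) \<Rightarrow> 'a set" where
  "sym_map n x = x ` {..<n}"

definition off_diag_topology :: "nat \<Rightarrow> (nat \<Rightarrow> 'a::topological_space) topology" where
  "off_diag_topology n = subtopology (product_topology (\<lambda>_. euclidean) {..<n}) (off_diag n)"

text \<open>The quotient topology with respect to \<^const>\<open>sym_map\<close>.\<close>

definition n_config_topology :: "nat \<Rightarrow> 'a::topological_space set topology" where
  "n_config_topology n = topology (\<lambda>U. U \<subseteq> n_configs UNIV n \<and>
     openin (off_diag_topology n) {x \<in> off_diag n. sym_map n x \<in> U})"

definition config_topology :: "'a::topological_space set topology" where
  "config_topology = topology (\<lambda>U. U \<subseteq> finite_configs \<and>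
     (\<forall>n. openin (n_config_topology n) (U \<inter> n_configs UNIV n)))"

lemma openin_n_config_topology:
  "openin (n_config_topology n) U \<longleftrightarrow> U \<subseteq> n_configs UNIV n \<and>
     openin (off_diag_topology n) {x \<in> off_diag n. sym_map n x \<in> U}"
proof -
  have "istopology (\<lambda>U. U \<subseteq> n_configs UNIV n \<and>
     openin (off_diag_topology n) {x \<in> off_diag n. sym_map n x \<in> (U :: 'a set set)})"
    unfolding istopology_def
  proof (intro conjI allI impI; (elim conjE)?)
    fix S T :: "'a set set"
    assume "S \<subseteq> n_configs UNIV n" "T \<subseteq> n_configs UNIV n"
      and "openin (off_diag_topology n) {x \<in> off_diag n. sym_map n x \<in> S}"
      and "openin (off_diag_topology n) {x \<in> off_diag n. sym_map n x \<in> T}"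
    moreover have "{x \<in> off_diag n. sym_map n x \<in> S \<inter> T} =
        {x \<in> off_diag n. sym_map n x \<in> S} \<inter> {x \<in> off_diag n. sym_map n x \<in> T}"
      by auto
    ultimately show "S \<inter> T \<subseteq> n_configs UNIV n"
      and "openin (off_diag_topology n) {x \<in> off_diag n. sym_map n x \<in> S \<inter> T}"
      by auto
  next
    fix K :: "'a set set set"
    assume K: "\<forall>S\<in>K. S \<subseteq> n_configs UNIV n \<and>
        openin (off_diag_topology n) {x \<in> off_diag n. sym_map n x \<in> S}"
    have "{x \<in> off_diag n. sym_map n x \<in> \<Union>K} = (\<Union>S\<in>K. {x \<in> off_diag n. sym_map n x \<in> S})"
      by auto
    with K show "\<Union>K \<subseteq> n_configs UNIV n"
      and "openin (off_diag_topology n) {x \<in> off_diag n. sym_map n x \<in> \<Union>K}"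
      by auto
  qed
  then show ?thesis
    by (simp add: n_config_topology_def topology_inverse')
qed

lemma openin_config_topology:
  "openin config_topology U \<longleftrightarrow> U \<subseteq> finite_configs \<and>
     (\<forall>n. openin (n_config_topology n) (U \<inter> n_configs UNIV n))"
proof -
  have "istopology (\<lambda>U. U \<subseteq> (finite_configs :: 'a set set) \<and>
     (\<forall>n. openin (n_config_topology n) (U \<inter> n_configs UNIV n)))"
    unfolding istopology_def
  proof (intro conjI allI impI; (elim conjE)?)
    fix S T :: "'a set set" and n
    assume "S \<subseteq> finite_configs" "T \<subseteq> finite_configs"
    then show "S \<inter> T \<subseteq> finite_configs" by auto
  next
    fix S T :: "'a set set" and n
    assume "\<forall>n. openin (n_config_topology n) (S \<inter> n_configs UNIV n)"
      "\<forall>n. openin (n_config_topology n) (T \<inter> n_configs UNIV n)"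
    moreover have "S \<inter> T \<inter> n_configs UNIV n = (S \<inter> n_configs UNIV n) \<inter> (T \<inter> n_configs UNIV n)"
      by auto
    ultimately show "openin (n_config_topology n) (S \<inter> T \<inter> n_configs UNIV n)" by auto
  next
    fix K :: "'a set set set"
    assume "\<forall>S\<in>K. S \<subseteq> finite_configs \<and>
      (\<forall>n. openin (n_config_topology n) (S \<inter> n_configs UNIV n))"
    then show "\<Union>K \<subseteq> finite_configs" by auto
  next
    fix K :: "'a set set set" and n
    assume "\<forall>S\<in>K. S \<subseteq> finite_configs \<and>
      (\<forall>n. openin (n_config_topology n) (S \<inter> n_configs UNIV n))"
    then have "openin (n_config_topology n) T" if "T \<in> (\<lambda>S. S \<inter> n_configs UNIV n) ` K" for T
      using that by blast
    then have "openin (n_config_topology n) (\<Union>S\<in>K. S \<inter> n_configs UNIV n)"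
      by (rule openin_Union)
    moreover have "\<Union>K \<inter> n_configs UNIV n = (\<Union>S\<in>K. S \<inter> n_configs UNIV n)" by auto
    ultimately show "openin (n_config_topology n) (\<Union>K \<inter> n_configs UNIV n)" by (simp only:)
  qed
  then show ?thesis
    by (simp add: config_topology_def topology_inverse')
qed

definition config_borel :: "'a::topological_space set measure" where
  "config_borel = sigma finite_configs {U. openin config_topology U}"

text \<open>
  The measure \<open>\<mu>\<^sup>(\<^sup>n\<^sup>)\<close>. The product over the empty index set is the unit mass at the unique
  element of \<open>M\<^sup>0\<close>, so for \<open>n = 0\<close> this is the unit mass at \<open>{}\<close>.
\<close>

definition n_config_measure ::
  "'a::topological_space measure \<Rightarrow> nat \<Rightarrow> 'a set measure" where
  "n_config_measure \<mu> n =
     distr (restrict_space (PiM {..<n} (\<lambda>_. \<mu>)) (off_diag n)) config_borel (sym_map n)"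

definition weighted_config_measure ::
  "(nat \<Rightarrow> real) \<Rightarrow> 'a::topological_space measure \<Rightarrow> 'a set measure" where
  "weighted_config_measure w \<mu> = measure_of finite_configs (sets config_borel)
     (\<lambda>B. \<Sum>n. ennreal (w n) * emeasure (n_config_measure \<mu> n) B)"

lemma space_config_borel: "space (config_borel :: 'a::topological_space set measure) = finite_configs"
proof -
  have "{U :: 'a set set. openin config_topology U} \<subseteq> Pow finite_configs"
    by (metis (no_types, lifting) PowI mem_Collect_eq openin_config_topology subsetI)
  then show ?thesis
    unfolding config_borel_def by (rule space_measure_of)
qed

lemma sets_config_borel_subset:
  "sets (config_borel :: 'a::topological_space set measure) \<subseteq> Pow finite_configs"
  using sets.space_closed[of "config_borel :: 'a set measure"] by (simp add: space_config_borel)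

lemma space_weighted_config_measure: "space (weighted_config_measure w \<mu>) = finite_configs"
  unfolding weighted_config_measure_def by (rule space_measure_of) (rule sets_config_borel_subset)

lemma sets_weighted_config_measure:
  fixes \<mu> :: "'a::topological_space measure"
  shows "sets (weighted_config_measure w \<mu>) = sets config_borel"
  using sets.sigma_sets_eq[of "config_borel :: 'a set measure"]
  by (simp add: weighted_config_measure_def space_config_borel
      sets_measure_of[OF sets_config_borel_subset])

lemma emeasure_weighted_config_measure:
  assumes "B \<in> sets config_borel"
  shows "emeasure (weighted_config_measure w \<mu>) B =
    (\<Sum>n. ennreal (w n) * emeasure (n_config_measure \<mu> n) B)"
proof (rule emeasure_measure_of[OF weighted_config_measure_def])
  show "sets config_borel \<subseteq> Pow finite_configs"
    by (rule sets_config_borel_subset)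
  show "B \<in> sets (weighted_config_measure w \<mu>)"
    using assms by (simp add: sets_weighted_config_measure)
  show "positive (sets (weighted_config_measure w \<mu>))
     (\<lambda>B. \<Sum>n. ennreal (w n) * emeasure (n_config_measure \<mu> n) B)"
    by (simp add: positive_def)
  show "countably_additive (sets (weighted_config_measure w \<mu>))
     (\<lambda>B. \<Sum>n. ennreal (w n) * emeasure (n_config_measure \<mu> n) B)"
  proof (rule countably_additiveI)
    fix F :: "nat \<Rightarrow> 'a set set"
    assume F: "range F \<subseteq> sets (weighted_config_measure w \<mu>)" "disjoint_family F"
    have *: "(\<Sum>i. emeasure (n_config_measure \<mu> n) (F i)) = emeasure (n_config_measure \<mu> n) (\<Union>i. F i)"
      for n
      using F by (intro suminf_emeasure) (auto simp: sets_weighted_config_measure n_config_measure_def)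
    have "(\<Sum>i. \<Sum>n. ennreal (w n) * emeasure (n_config_measure \<mu> n) (F i)) =
        (\<Sum>n. \<Sum>i. ennreal (w n) * emeasure (n_config_measure \<mu> n) (F i))"
      using nn_integral_suminf[of "\<lambda>i n. ennreal (w n) * emeasure (n_config_measure \<mu> n) (F i)"
          "count_space UNIV"]
      unfolding nn_integral_count_space_nat by simp
    also have "\<dots> = (\<Sum>n. ennreal (w n) * emeasure (n_config_measure \<mu> n) (\<Union>i. F i))"
      by (simp add: *)
    finally show "(\<Sum>i. \<Sum>n. ennreal (w n) * emeasure (n_config_measure \<mu> n) (F i)) =
        (\<Sum>n. ennreal (w n) * emeasure (n_config_measure \<mu> n) (\<Union>i. F i))" .
  qed
qed

definition lambda_mu :: "'a::topological_space measure \<Rightarrow> 'a set measure" where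
  "lambda_mu \<mu> = weighted_config_measure (\<lambda>n. 1 / fact n) \<mu>"

definition lambda_mu_frac :: "real \<Rightarrow> 'a::topological_space measure \<Rightarrow> 'a set measure" where
  "lambda_mu_frac \<alpha> \<mu> = weighted_config_measure (\<lambda>n. 1 / Gamma (\<alpha> * real n + 1)) \<mu>"


section \<open>Operators\<close>

text \<open>
  \<open>L\<^sup>2\<close> spaces are represented by their square-integrable representatives; the equality of the
  quotient space is \<open>L2_eq\<close>.
\<close>

definition L2 :: "'b measure \<Rightarrow> ('b \<Rightarrow> complex) set" where
  "L2 N = {f \<in> borel_measurable N. integrable N (\<lambda>x. (cmod (f x))\<^sup>2)}"

definition L2_eq :: "'b measure \<Rightarrow> ('b \<Rightarrow> complex) \<Rightarrow> ('b \<Rightarrow> complex) \<Rightarrow> bool" where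
  "L2_eq N f h \<longleftrightarrow> f \<in> L2 N \<and> h \<in> L2 N \<and> (AE x in N. f x = h x)"

definition mittag_leffler :: "real \<Rightarrow> complex \<Rightarrow> complex" where
  "mittag_leffler \<alpha> z = (\<Sum>n. z ^ n / of_real (Gamma (\<alpha> * real n + 1)))"

definition mittag_leffler_deriv0 :: "real \<Rightarrow> nat \<Rightarrow> complex" where
  "mittag_leffler_deriv0 \<alpha> n = (deriv ^^ n) (mittag_leffler \<alpha>) 0"

definition I_op :: "real \<Rightarrow> ('a set \<Rightarrow> complex) \<Rightarrow> ('a set \<Rightarrow> complex)" where
  "I_op \<alpha> G = (\<lambda>\<eta>. G \<eta> * csqrt (mittag_leffler_deriv0 \<alpha> (card \<eta>)))"

text \<open>
  \<^term>\<open>I_op\<close> is pointwise injective, since the factors are nonzero also for \<open>card \<eta> = 0\<close>; so the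
  choice made by \<^const>\<open>inv_into\<close> is unique on the image of \<^const>\<open>L2\<close>.
\<close>

definition I_op_inv ::
  "real \<Rightarrow> 'a::topological_space measure \<Rightarrow> ('a set \<Rightarrow> complex) \<Rightarrow> ('a set \<Rightarrow> complex)" where
  "I_op_inv \<alpha> \<mu> = inv_into (L2 (lambda_mu_frac \<alpha> \<mu>)) (I_op \<alpha>)"

definition B_bs :: "('a::topological_space set \<Rightarrow> complex) set" where
  "B_bs = {G \<in> borel_measurable config_borel.
     (\<exists>C. \<forall>\<eta>\<in>finite_configs. cmod (G \<eta>) \<le> C) \<and>
     (\<exists>N \<Lambda>. \<Lambda> \<in> sets borel \<and> compact (closure \<Lambda>) \<and>
        (\<forall>\<eta>\<in>finite_configs. \<eta> \<notin> (\<Union>n\<le>N. n_configs \<Lambda> n) \<longrightarrow> G \<eta> = 0))}"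

definition annihilation ::
  "'a measure \<Rightarrow> ('a \<Rightarrow> complex) \<Rightarrow> ('a set \<Rightarrow> complex) \<Rightarrow> ('a set \<Rightarrow> complex)" where
  "annihilation \<mu> \<phi> G = (\<lambda>\<eta>. \<integral>x. G (\<eta> \<union> {x}) * \<phi> x \<partial>\<mu>)"

definition creation ::
  "('a \<Rightarrow> complex) \<Rightarrow> ('a set \<Rightarrow> complex) \<Rightarrow> ('a set \<Rightarrow> complex)" where
  "creation \<phi> G = (\<lambda>\<eta>. \<Sum>x\<in>\<eta>. G (\<eta> - {x}) * \<phi> x)"

definition annihilation_frac ::
  "real \<Rightarrow> 'a::topological_space measure \<Rightarrow> ('a \<Rightarrow> complex)
     \<Rightarrow> ('a set \<Rightarrow> complex) \<Rightarrow> ('a set \<Rightarrow> complex)" where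
  "annihilation_frac \<alpha> \<mu> \<phi> = I_op_inv \<alpha> \<mu> \<circ> annihilation \<mu> \<phi> \<circ> I_op \<alpha>"

definition creation_frac ::
  "real \<Rightarrow> 'a::topological_space measure \<Rightarrow> ('a \<Rightarrow> complex)
     \<Rightarrow> ('a set \<Rightarrow> complex) \<Rightarrow> ('a set \<Rightarrow> complex)" where
  "creation_frac \<alpha> \<mu> \<phi> = I_op_inv \<alpha> \<mu> \<circ> creation \<phi> \<circ> I_op \<alpha>"

end

theory Submission
  imports Defs
begin

text \<open>
  Pointwise the identities are immediate: a point is \<open>\<mu>\<close>-null, so adding \<open>x\<close> to \<open>\<eta>\<close> raises the
  cardinality by one for almost all \<open>x\<close>, while removing a point lowers it by one; and
  \<open>E\<^sub>\<alpha>\<^sup>(\<^sup>n\<^sup>)(0) = n! / \<Gamma>(\<alpha>n + 1)\<close> is positive, so the square root of the quotient is the quotient of the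
  square roots. The work lies in showing that both operators preserve \<open>B_bs\<close>, which is contained in
  all the \<open>L\<^sup>2\<close> spaces involved. For measurability, the Borel \<open>\<sigma>\<close>-algebra of the configuration space
  is described by the counting functions \<open>\<eta> \<mapsto> |\<eta> \<inter> U|\<close>, \<open>U\<close> open: by the Hausdorff property, every open
  set of configurations is a countable union of cells, which prescribe exactly one point in each of
  finitely many disjoint basic open sets.
\<close>

section \<open>Derivatives of the Mittag-Leffler function at zero\<close>

text \<open>From 2 on, \<open>Gamma\<close> increases and starts at 1; for x in [1, 2) the
  functional equation gives \<open>Gamma x = Gamma (x + 1) / x\<close>, with numerator at least 1
  and denominator below 2. The crude bound serves to keep the coefficients of the Mittag-Leffler
  series bounded.\<close>

lemma Gamma_real_ge:
  fixes x :: real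
  assumes "x \<ge> 1"
  shows "Gamma x \<ge> 1 / 2"
proof -
  have step: "Gamma y \<ge> 1" if "y \<ge> 2" for y :: real
    using Gamma_real_strict_mono[of 2 y] that by (cases "y = 2") (auto simp: Gamma_numeral)
  have "Gamma (x + 1) = x * Gamma x"
    using assms by (intro Gamma_plus1) (auto elim!: nonpos_Ints_cases)
  show ?thesis
  proof (cases "x \<ge> 2")
    case True
    then show ?thesis using step[of x] by simp
  next
    case False
    have "1 \<le> x * Gamma x"
      using step[of "x + 1"] assms \<open>Gamma (x + 1) = _\<close> by simp
    also have "\<dots> \<le> 2 * Gamma x"
      using False assms by (intro mult_right_mono) (auto intro!: less_imp_le Gamma_real_pos)
    finally show ?thesis by simp
  qed
qed

text \<open>The coefficients are at most 2 in modulus, so the power series has a positive radius of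
  convergence, and its n-th derivative at 0 is n! times the n-th coefficient.\<close>

lemma mittag_leffler_deriv0_eq:
  assumes "\<alpha> > 0"
  shows "mittag_leffler_deriv0 \<alpha> n = of_real (fact n / Gamma (\<alpha> * real n + 1))"
proof -
  define F where "F = Abs_fps (\<lambda>n. 1 / complex_of_real (Gamma (\<alpha> * real n + 1)))"
  \<comment> \<open>The point 1/2 is an arbitrary choice in the punctured open unit disc:
    convergence at one nonzero point already makes the radius positive.\<close>
  have "summable (\<lambda>n. fps_nth F n * (1/2) ^ n)"
  proof (rule summable_comparison_test')
    show "summable (\<lambda>n. 2 * (1/2::real) ^ n)"
      by (intro summable_mult summable_geometric) simp
    fix n :: nat
    have "Gamma (\<alpha> * real n + 1) \<ge> 1 / 2"
      using assms by (intro Gamma_real_ge) simp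
    then have "norm (fps_nth F n) \<le> 2"
      by (simp add: F_def norm_divide field_simps)
    then show "norm (fps_nth F n * (1/2) ^ n) \<le> 2 * (1/2) ^ n"
      by (simp add: norm_mult norm_power norm_divide mult_right_mono)
  qed
  then have "fps_conv_radius F \<ge> norm (1/2 :: complex)"
    unfolding fps_conv_radius_def by (rule conv_radius_geI)
  then have "fps_conv_radius F > 0"
    by (rule less_le_trans[rotated]) (simp add: norm_divide)
  moreover have "mittag_leffler \<alpha> = eval_fps F"
    by (simp add: mittag_leffler_def eval_fps_def F_def fun_eq_iff)
  ultimately show ?thesis
    using fps_nth_conv_deriv[of F n] by (simp add: mittag_leffler_deriv0_def F_def field_simps)
qed

section \<open>The Borel sets of the configuration space\<close>

lemma card_insert_Int:
  assumes "finite \<eta>"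
  shows "card (insert x \<eta> \<inter> U) = card (\<eta> \<inter> U) + (if x \<in> U \<and> x \<notin> \<eta> then 1 else 0)"
  using assms by (simp add: Int_insert_left insert_absorb card_insert_if)

text \<open>Subtraction is truncated; if \<open>\<eta> \<inter> U\<close> is infinite, both sides
  are 0.\<close>

lemma card_remove_Int:
  "card ((\<eta> - {x}) \<inter> U) = card (\<eta> \<inter> U) - (if x \<in> U \<and> x \<in> \<eta> then 1 else 0)"
proof -
  have "(\<eta> - {x}) \<inter> U = (\<eta> \<inter> U) - {x}"
    by blast
  then show ?thesis
    by (simp add: card_Diff_singleton_if)
qed

lemma finite_configs_eq: "finite_configs = {\<eta>. finite \<eta>}"
  by (auto simp: finite_configs_def n_configs_def)

lemma sym_map_in_n_configs: "x \<in> off_diag n \<Longrightarrow> sym_map n x \<in> n_configs UNIV n"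
  by (auto simp: off_diag_def sym_map_def n_configs_def card_image)

lemma topspace_off_diag_topology: "topspace (off_diag_topology n) = off_diag n"
  by (auto simp: off_diag_topology_def off_diag_def PiE_def)

text \<open>Pulled back to tuples, the condition says that at least k coordinates lie in U. This is
  a union, over the index sets I of size at least k, of open boxes restricting the coordinates in I
  to U.\<close>

lemma openin_card_Int_ge:
  assumes "open U"
  shows "openin config_topology {\<eta> \<in> finite_configs. k \<le> card (\<eta> \<inter> U)}"
  unfolding openin_config_topology openin_n_config_topology
proof (intro conjI allI)
  fix n :: nat
  let ?B = "\<lambda>I. Pi\<^sub>E {..<n} (\<lambda>i. if i \<in> I then U else UNIV)"
  \<comment> \<open>Injectivity of x makes the points of the image in U correspond to the
    coordinates in U.\<close>
  have *: "card (sym_map n x \<inter> U) = card {i \<in> {..<n}. x i \<in> U}" if "x \<in> off_diag n" for x :: "nat \<Rightarrow> 'a"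
  proof -
    have "sym_map n x \<inter> U = x ` {i \<in> {..<n}. x i \<in> U}"
      by (auto simp: sym_map_def)
    then show ?thesis
      using that by (auto simp: off_diag_def intro!: card_image inj_on_subset[of x "{..<n}"])
  qed
  have "{x \<in> off_diag n. sym_map n x \<in> {\<eta> \<in> finite_configs. k \<le> card (\<eta> \<inter> U)} \<inter> n_configs UNIV n}
      = {x \<in> off_diag n. k \<le> card {i \<in> {..<n}. x i \<in> U}}"
    using sym_map_in_n_configs[of _ n] by (auto simp: * finite_configs_def)
  also have "\<dots> = (\<Union>I\<in>{I. I \<subseteq> {..<n} \<and> k \<le> card I}. ?B I) \<inter> off_diag n" (is "?L = ?R")
  proof (intro equalityI subsetI)
    fix x assume "x \<in> ?L"
    then have "x \<in> ?B {i \<in> {..<n}. x i \<in> U}"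
      by (simp add: off_diag_def PiE_iff)
    moreover have "{i \<in> {..<n}. x i \<in> U} \<in> {I. I \<subseteq> {..<n} \<and> k \<le> card I}"
      using \<open>x \<in> ?L\<close> by blast
    ultimately show "x \<in> ?R"
      using \<open>x \<in> ?L\<close> by blast
  next
    fix x assume "x \<in> ?R"
    then obtain I where I: "I \<subseteq> {..<n}" "k \<le> card I" "x \<in> ?B I" and x: "x \<in> off_diag n"
      by auto
    then have "I \<subseteq> {i \<in> {..<n}. x i \<in> U}"
      by (force simp: PiE_iff)
    then have "card I \<le> card {i \<in> {..<n}. x i \<in> U}"
      by (intro card_mono) auto
    with I x show "x \<in> ?L" by simp
  qed
  also have "openin (off_diag_topology n) \<dots>"
    unfolding off_diag_topology_def openin_subtopology
  proof (intro exI[of _ "\<Union>I\<in>{I. I \<subseteq> {..<n} \<and> k \<le> card I}. ?B I"] conjI refl openin_Union)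
    fix S assume "S \<in> ?B ` {I. I \<subseteq> {..<n} \<and> k \<le> card I}"
    then show "openin (product_topology (\<lambda>_. euclidean) {..<n}) S"
      using assms by (auto simp: openin_PiE_gen)
  qed
  finally show "openin (off_diag_topology n)
    {x \<in> off_diag n. sym_map n x \<in> {\<eta> \<in> finite_configs. k \<le> card (\<eta> \<inter> U)} \<inter> n_configs UNIV n}" .
qed (simp_all add: Collect_restrict)

text \<open>Superlevel sets of the counting function are open, and each level set is the difference
  of two consecutive ones.\<close>

lemma measurable_card_Int:
  assumes "open U"
  shows "(\<lambda>\<eta>. card (\<eta> \<inter> U)) \<in> measurable config_borel (count_space UNIV)"
proof -
  have *: "{\<eta> \<in> finite_configs. k \<le> card (\<eta> \<inter> U)} \<in> sets config_borel" for k
    unfolding config_borel_def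
    by (intro in_measure_of) (use openin_card_Int_ge[OF assms, of k] openin_config_topology in auto)
  have "(\<lambda>\<eta>. card (\<eta> \<inter> U)) -` {k} \<inter> space config_borel \<in> sets config_borel" for k
  proof -
    have "(\<lambda>\<eta>. card (\<eta> \<inter> U)) -` {k} \<inter> space config_borel =
      {\<eta> \<in> finite_configs. k \<le> card (\<eta> \<inter> U)} - {\<eta> \<in> finite_configs. Suc k \<le> card (\<eta> \<inter> U)}"
      by (auto simp: space_config_borel)
    then show ?thesis using * by auto
  qed
  then show ?thesis
    by (subst measurable_count_space_eq_countable) (auto simp: countableI_type)
qed

section \<open>Cells generate the Borel sets of configurations\<close>

definition cell :: "'a set set \<Rightarrow> 'a set set" where
  "cell \<U> = {\<eta>. finite \<eta> \<and> \<eta> \<subseteq> \<Union>\<U> \<and> (\<forall>U\<in>\<U>. card (\<eta> \<inter> U) = 1)}"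

text \<open>Disjointness puts each point of a configuration in \<open>cell \<U>\<close> into exactly
  one member of \<U>, so the members of \<U> index its points. The empty family is included; its
  cell contains only the empty configuration.\<close>

definition cells :: "'a set set \<Rightarrow> 'a set set set" where
  "cells \<B> = {\<U>. finite \<U> \<and> \<U> \<subseteq> \<B> \<and> disjoint \<U>}"

lemma countable_cells: "countable \<B> \<Longrightarrow> countable (cells \<B>)"
  by (rule countable_subset[OF _ countable_Collect_finite_subset[of \<B>]]) (auto simp: cells_def)

lemma finite_disjoint_nhds:
  fixes \<eta> :: "'a::t2_space set"
  assumes "finite \<eta>"
  obtains V where "\<And>p. open (V p)" "\<And>p. p \<in> V p"
    "\<And>p q. p \<in> \<eta> \<Longrightarrow> q \<in> \<eta> \<Longrightarrow> p \<noteq> q \<Longrightarrow> V p \<inter> V q = {}"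
proof -
  define sep where "sep p q Z \<longleftrightarrow> open (fst Z) \<and> open (snd Z) \<and> p \<in> fst Z \<and> q \<in> snd Z \<and>
      fst Z \<inter> snd Z = {}" for p q :: 'a and Z
  define X where "X p q = fst (SOME Z. sep p q Z)" for p q
  define Y where "Y p q = snd (SOME Z. sep p q Z)" for p q
  have XY: "open (X p q) \<and> open (Y p q) \<and> p \<in> X p q \<and> q \<in> Y p q \<and> X p q \<inter> Y p q = {}"
    if "p \<noteq> q" for p q
  proof -
    obtain U V where "open U" "open V" "p \<in> U" "q \<in> V" "U \<inter> V = {}"
      using hausdorff[OF \<open>p \<noteq> q\<close>] by blast
    then have "sep p q (U, V)"
      by (simp add: sep_def)
    then have "sep p q (SOME Z. sep p q Z)"
      by (rule someI)
    then have "sep p q (X p q, Y p q)"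
      by (simp add: X_def Y_def)
    then show ?thesis
      by (simp add: sep_def)
  qed
  \<comment> \<open>The pair chosen for (p, q) need not be the mirror image of the one chosen for
    (q, p), so p has to use its set from both. Then \<open>?V p\<close> lies in \<open>X p q\<close>
    and \<open>?V q\<close> in \<open>Y p q\<close>, which are disjoint.\<close>
  let ?V = "\<lambda>p. \<Inter>q\<in>\<eta> - {p}. X p q \<inter> Y q p"
  show ?thesis
  proof (rule that[of ?V])
    show "open (?V p)" for p
    proof (intro open_INT ballI open_Int)
      fix q assume "q \<in> \<eta> - {p}"
      then show "open (X p q)" "open (Y q p)"
        using XY[of p q] XY[of q p] by auto
    qed (use assms in simp)
    show "p \<in> ?V p" for p
    proof
      fix q assume "q \<in> \<eta> - {p}"
      then show "p \<in> X p q \<inter> Y q p"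
        using XY[of p q] XY[of q p] by auto
    qed
    show "?V p \<inter> ?V q = {}" if "p \<in> \<eta>" "q \<in> \<eta>" "p \<noteq> q" for p q
    proof -
      have "?V p \<inter> ?V q \<subseteq> X p q \<inter> Y p q"
        using that by blast
      then show ?thesis
        using XY[OF that(3)] by auto
    qed
  qed
qed

text \<open>List \<eta> as a tuple x. The tuples representing elements of \<V> form an open set,
  which contains the off-diagonal part of a box around x. Shrinking its sides to disjoint basic sets
  gives a cell around \<eta>, and every configuration in that cell has a listing inside the
  box.\<close>

lemma cell_neighbourhood:
  fixes \<V> :: "'a::t2_space set set"
  assumes \<B>: "topological_basis \<B>"
    and \<V>: "openin config_topology \<V>"
    and \<eta>: "\<eta> \<in> \<V>"
  shows "\<exists>\<U>\<in>cells \<B>. \<eta> \<in> cell \<U> \<and> cell \<U> \<subseteq> \<V>"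
proof -
  define n where "n = card \<eta>"
  have "\<eta> \<in> finite_configs"
    using \<V> \<eta> unfolding openin_config_topology by blast
  then have fin: "finite \<eta>"
    by (simp add: finite_configs_eq)
  obtain x0 where x0: "bij_betw x0 {..<n} \<eta>"
    using ex_bij_betw_nat_finite[OF fin] by (auto simp: n_def atLeast0LessThan)
  \<comment> \<open>Tuples in \<open>off_diag\<close> are extensional, so the enumeration must be
    cut down to its index set.\<close>
  define x where "x = restrict x0 {..<n}"
  have x: "bij_betw x {..<n} \<eta>"
    by (rule iffD2[OF bij_betw_cong x0]) (simp add: x_def)
  have x_off: "x \<in> off_diag n" and sym_x: "sym_map n x = \<eta>"
    using x by (auto simp: off_diag_def sym_map_def x_def bij_betw_def)
  let ?S = "{x \<in> off_diag n. sym_map n x \<in> \<V> \<inter> n_configs UNIV n}"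
  have "openin (off_diag_topology n) ?S"
    using \<V> by (auto simp: openin_config_topology openin_n_config_topology)
  then obtain T where T: "openin (product_topology (\<lambda>_. euclidean) {..<n}) T" "?S = T \<inter> off_diag n"
    by (auto simp: off_diag_topology_def openin_subtopology)
  have "x \<in> ?S"
    using x_off sym_x \<eta> sym_map_in_n_configs[OF x_off] by auto
  then have "x \<in> T"
    using T by auto
  then obtain W where W: "\<forall>i\<in>{..<n}. open (W i)" "x \<in> Pi\<^sub>E {..<n} W" "Pi\<^sub>E {..<n} W \<subseteq> T"
    using T(1) unfolding openin_product_topology_alt by auto
  obtain V where V: "\<And>p. open (V p)" "\<And>p. p \<in> V p"
    "\<And>p q. p \<in> \<eta> \<Longrightarrow> q \<in> \<eta> \<Longrightarrow> p \<noteq> q \<Longrightarrow> V p \<inter> V q = {}"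
    using finite_disjoint_nhds[OF fin] by metis
  have "\<exists>b\<in>\<B>. x i \<in> b \<and> b \<subseteq> W i \<inter> V (x i)" if "i < n" for i
  proof -
    have "open (W i \<inter> V (x i))" "x i \<in> W i \<inter> V (x i)"
      using that W V by auto
    then show ?thesis
      using topological_basisE[OF \<B>] by metis
  qed
  then obtain b where b: "\<And>i. i < n \<Longrightarrow> b i \<in> \<B> \<and> x i \<in> b i \<and> b i \<subseteq> W i \<inter> V (x i)"
    by metis
  have x_img: "x i \<in> \<eta>" if "i < n" for i
    using x that by (auto simp: bij_betw_def)
  have dis: "b i \<inter> b j = {}" if "i < n" "j < n" "i \<noteq> j" for i j
  proof -
    have "x i \<noteq> x j"
      using x that by (auto simp: bij_betw_def inj_on_def)
    then have "V (x i) \<inter> V (x j) = {}"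
      using V(3) x_img that by auto
    then show ?thesis
      using b[OF that(1)] b[OF that(2)] by blast
  qed
  let ?\<U> = "b ` {..<n}"
  have "disjoint ?\<U>"
    using dis by (auto simp: disjoint_def)
  then have \<U>: "?\<U> \<in> cells \<B>"
    using b by (auto simp: cells_def)
  have "\<eta> \<inter> b i = {x i}" if "i < n" for i
  proof -
    have "\<eta> = x ` {..<n}"
      using x by (auto simp: bij_betw_def)
    moreover have "x j \<notin> b i" if "j < n" "j \<noteq> i" for j
      using dis[OF that(1) \<open>i < n\<close> that(2)] b[OF that(1)] by auto
    ultimately show ?thesis
      using b[OF that] that by auto
  qed
  then have "\<forall>U\<in>?\<U>. card (\<eta> \<inter> U) = 1"
    by simp
  moreover have "\<eta> \<subseteq> \<Union>?\<U>"
  proof -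
    have "\<eta> = x ` {..<n}"
      using x by (simp add: bij_betw_def)
    also have "\<dots> \<subseteq> \<Union>?\<U>"
      using b by blast
    finally show ?thesis .
  qed
  ultimately have "\<eta> \<in> cell ?\<U>"
    using fin by (simp add: cell_def)
  moreover have "cell ?\<U> \<subseteq> \<V>"
  proof
    fix \<xi> assume \<xi>: "\<xi> \<in> cell ?\<U>"
    \<comment> \<open>The unique points of \<xi> in the sets \<open>b i\<close> give its listing; it
      is injective because these sets are disjoint, and exhaustive because they cover \<xi>.\<close>
    then have "card (\<xi> \<inter> b i) = 1" if "i < n" for i
      using that by (simp add: cell_def)
    then have "\<exists>y. \<xi> \<inter> b i = {y}" if "i < n" for i
      using that by (meson card_1_singletonE)
    then obtain y0 where y0: "\<And>i. i < n \<Longrightarrow> \<xi> \<inter> b i = {y0 i}"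
      by metis
    define y where "y = restrict y0 {..<n}"
    have y: "\<xi> \<inter> b i = {y i}" if "i < n" for i
      using y0 that by (auto simp: y_def)
    have "inj_on y {..<n}"
    proof (rule inj_onI)
      fix i j assume "i \<in> {..<n}" "j \<in> {..<n}" "y i = y j"
      then show "i = j"
        using dis[of i j] y[of i] y[of j] by auto
    qed
    then have y_off: "y \<in> off_diag n"
      by (auto simp: off_diag_def y_def)
    have "y \<in> Pi\<^sub>E {..<n} W"
    proof (rule PiE_I)
      show "y i \<in> W i" if "i \<in> {..<n}" for i
        using y[of i] b[of i] that by auto
    qed (simp add: y_def)
    then have "y \<in> ?S"
      using y_off W T by auto
    moreover have "sym_map n y = \<xi>"
    proof -
      have "\<xi> = (\<Union>i<n. \<xi> \<inter> b i)"
        using \<xi> unfolding cell_def by blast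
      also have "\<dots> = (\<Union>i<n. {y i})"
        using y by simp
      finally show ?thesis
        by (auto simp: sym_map_def)
    qed
    ultimately show "\<xi> \<in> \<V>"
      by simp
  qed
  ultimately show ?thesis
    using \<U> by (intro bexI[of _ ?\<U>] conjI)
qed

lemma sets_Collect_nat_eq:
  fixes f g :: "'b \<Rightarrow> nat"
  assumes "f \<in> measurable M (count_space UNIV)" "g \<in> measurable M (count_space UNIV)"
  shows "{x \<in> space M. f x = g x} \<in> sets M"
proof -
  have "{x \<in> space M. f x = g x} = (\<Union>n. (f -` {n} \<inter> space M) \<inter> (g -` {n} \<inter> space M))"
    by auto
  also have "\<dots> \<in> sets M"
    using assms by (intro sets.countable_UN' sets.Int) (auto intro: measurable_sets)
  finally show ?thesis .
qed

text \<open>For finite configurations the inclusion in \<open>\<Union>\<U>\<close> amounts to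
  equality of two counts, so membership in a cell is expressed by counting functions alone.\<close>

lemma measurable_vimage_cell:
  assumes f: "f \<in> space M \<rightarrow> finite_configs"
    and cnt: "\<And>U. open U \<Longrightarrow> (\<lambda>x. card (f x \<inter> U)) \<in> measurable M (count_space UNIV)"
    and \<U>: "finite \<U>" "\<And>U. U \<in> \<U> \<Longrightarrow> open U"
  shows "f -` cell \<U> \<inter> space M \<in> sets M"
proof -
  have fin: "finite (f x)" if "x \<in> space M" for x
    using f that by (auto simp: finite_configs_eq)
  have sub: "f x \<subseteq> \<Union>\<U> \<longleftrightarrow> card (f x \<inter> \<Union>\<U>) = card (f x \<inter> UNIV)" if "x \<in> space M" for x
    using card_subset_eq[OF fin[OF that], of "f x \<inter> \<Union>\<U>"]
    by (auto simp: Int_absorb2)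
  have *: "(\<lambda>x. card (f x \<inter> UNIV)) \<in> measurable M (count_space UNIV)"
    "(\<lambda>x. card (f x \<inter> \<Union>\<U>)) \<in> measurable M (count_space UNIV)"
    using cnt[of UNIV] cnt[of "\<Union>\<U>"] open_Union[of \<U>] \<U>(2) by simp_all
  have "f -` cell \<U> \<inter> space M = {x \<in> space M. card (f x \<inter> \<Union>\<U>) = card (f x \<inter> UNIV) \<and>
      (\<forall>U\<in>\<U>. card (f x \<inter> U) = 1)}"
  proof (intro set_eqI iffI)
    fix x assume "x \<in> f -` cell \<U> \<inter> space M"
    then show "x \<in> {x \<in> space M. card (f x \<inter> \<Union>\<U>) = card (f x \<inter> UNIV) \<and>
      (\<forall>U\<in>\<U>. card (f x \<inter> U) = 1)}"
      using sub[of x] unfolding cell_def by simp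
  next
    fix x assume "x \<in> {x \<in> space M. card (f x \<inter> \<Union>\<U>) = card (f x \<inter> UNIV) \<and>
      (\<forall>U\<in>\<U>. card (f x \<inter> U) = 1)}"
    then show "x \<in> f -` cell \<U> \<inter> space M"
      using sub[of x] fin[of x] unfolding cell_def by simp
  qed
  also have "\<dots> \<in> sets M"
  proof (intro sets.sets_Collect_conj sets.sets_Collect_finite_All)
    show "{x \<in> space M. card (f x \<inter> \<Union>\<U>) = card (f x \<inter> UNIV)} \<in> sets M"
      using * by (intro sets_Collect_nat_eq)
    show "{x \<in> space M. card (f x \<inter> U) = 1} \<in> sets M" if "U \<in> \<U>" for U
      using that \<U> by (intro sets_Collect_nat_eq cnt) auto
  qed fact
  finally show ?thesis .
qed

lemma ex_countable_topological_basis: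
  obtains \<B> :: "'a::second_countable_topology set set"
  where "countable \<B>" "topological_basis \<B>"
  using ex_countable_basis by blast

text \<open>Over a countable basis there are only countably many cells, and every open set of
  configurations is the union of the cells it contains; its preimage is therefore a countable union
  of measurable sets. This criterion handles all configuration-valued maps below.\<close>

lemma measurable_config_borelI:
  fixes f :: "'b \<Rightarrow> 'a::{second_countable_topology, t2_space} set"
  assumes f: "f \<in> space M \<rightarrow> finite_configs"
    and cnt: "\<And>U. open U \<Longrightarrow> (\<lambda>x. card (f x \<inter> U)) \<in> measurable M (count_space UNIV)"
  shows "f \<in> measurable M config_borel"
  unfolding config_borel_def
proof (rule measurable_measure_of)
  show "{U :: 'a set set. openin config_topology U} \<subseteq> Pow finite_configs"
    by (auto simp: openin_config_topology)
  show "f \<in> space M \<rightarrow> finite_configs"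
    by fact
next
  fix \<V> :: "'a set set" assume "\<V> \<in> {U. openin config_topology U}"
  then have \<V>: "openin config_topology \<V>" by simp
  obtain \<B> :: "'a set set" where \<B>: "countable \<B>" "topological_basis \<B>"
    by (rule ex_countable_topological_basis)
  have "f -` \<V> \<inter> space M = (\<Union>\<U>\<in>{\<U> \<in> cells \<B>. cell \<U> \<subseteq> \<V>}. f -` cell \<U> \<inter> space M)"
  proof (intro equalityI subsetI)
    fix x assume x: "x \<in> f -` \<V> \<inter> space M"
    then obtain \<U> where "\<U> \<in> cells \<B>" "f x \<in> cell \<U>" "cell \<U> \<subseteq> \<V>"
      using cell_neighbourhood[OF \<B>(2) \<V>, of "f x"] by auto
    with x show "x \<in> (\<Union>\<U>\<in>{\<U> \<in> cells \<B>. cell \<U> \<subseteq> \<V>}. f -` cell \<U> \<inter> space M)"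
      by auto
  qed auto
  also have "\<dots> \<in> sets M"
  proof (rule sets.countable_UN')
    show "countable {\<U> \<in> cells \<B>. cell \<U> \<subseteq> \<V>}"
      using countable_cells[OF \<B>(1)] by (rule countable_subset[rotated]) auto
    show "(\<lambda>\<U>. f -` cell \<U> \<inter> space M) ` {\<U> \<in> cells \<B>. cell \<U> \<subseteq> \<V>} \<subseteq> sets M"
    proof (rule image_subsetI)
      fix \<U> assume "\<U> \<in> {\<U> \<in> cells \<B>. cell \<U> \<subseteq> \<V>}"
      then have "finite \<U>" "\<And>U. U \<in> \<U> \<Longrightarrow> open U"
        using topological_basis_open[OF \<B>(2)] by (auto simp: cells_def)
      with f cnt show "f -` cell \<U> \<inter> space M \<in> sets M"
        by (rule measurable_vimage_cell)
    qed
  qed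
  finally show "f -` \<V> \<inter> space M \<in> sets M" .
qed

lemma cell_in_sets_config_borel:
  assumes "finite \<U>" "\<And>U. U \<in> \<U> \<Longrightarrow> open U"
  shows "cell \<U> \<in> sets config_borel"
proof -
  have "(\<lambda>\<eta>. \<eta>) -` cell \<U> \<inter> space config_borel \<in> sets config_borel"
    using assms by (intro measurable_vimage_cell measurable_card_Int) (simp_all add: space_config_borel)
  moreover have "cell \<U> \<subseteq> finite_configs"
    by (auto simp: cell_def finite_configs_eq)
  ultimately show ?thesis
    by (simp add: space_config_borel Int_absorb2)
qed

section \<open>Adding and removing a point; sums over the points\<close>

lemma measurable_card_Int_pair:
  assumes "open U"
  shows "(\<lambda>p. card (fst p \<inter> U)) \<in> measurable (config_borel \<Otimes>\<^sub>M N) (count_space UNIV)"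
  using measurable_compose[OF measurable_fst measurable_card_Int[OF assms]] .

text \<open>A finite set is closed, so a point lies outside \<eta> iff some basic open set contains
  it and misses \<eta>. Non-membership is thus a countable union of measurable conditions.\<close>

lemma pred_mem_config:
  "Measurable.pred (config_borel \<Otimes>\<^sub>M (borel :: 'a::{second_countable_topology, t2_space} measure))
     (\<lambda>p. snd p \<in> fst p)"
proof -
  let ?M = "config_borel \<Otimes>\<^sub>M (borel :: 'a measure)"
  obtain \<B> :: "'a set set" where \<B>: "countable \<B>" "topological_basis \<B>"
    by (rule ex_countable_topological_basis)
  have fin: "finite (fst p)" if "p \<in> space ?M" for p
    using that by (auto simp: space_pair_measure space_config_borel finite_configs_eq)
  have "{p \<in> space ?M. snd p \<in> fst p} =
    space ?M - (\<Union>U\<in>\<B>. {p \<in> space ?M. card (fst p \<inter> U) = 0 \<and> snd p \<in> U})" (is "?L = ?R")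
  proof (intro equalityI subsetI)
    fix p assume "p \<in> ?L"
    then show "p \<in> ?R"
      using fin[of p] by auto
  next
    fix p assume p: "p \<in> ?R"
    show "p \<in> ?L"
    proof (rule ccontr)
      assume "p \<notin> ?L"
      with p have *: "p \<in> space ?M" "snd p \<in> - fst p" by auto
      then have "open (- fst p)"
        using fin finite_imp_closed by blast
      then obtain U where "U \<in> \<B>" "snd p \<in> U" "U \<subseteq> - fst p"
        using topological_basisE[OF \<B>(2) _ *(2)] by metis
      moreover from this have "fst p \<inter> U = {}" by auto
      ultimately show False
        using p *(1) by auto
    qed
  qed
  also have "\<dots> \<in> sets ?M"
  proof (intro sets.Diff sets.top sets.countable_UN' subsetI)
    fix S assume "S \<in> (\<lambda>U. {p \<in> space ?M. card (fst p \<inter> U) = 0 \<and> snd p \<in> U}) ` \<B>"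
    then obtain U where S: "S = {p \<in> space ?M. card (fst p \<inter> U) = 0 \<and> snd p \<in> U}" and "open U"
      using topological_basis_open[OF \<B>(2)] by auto
    then have [measurable]: "U \<in> sets borel"
      "(\<lambda>p. card (fst p \<inter> U)) \<in> measurable ?M (count_space UNIV)"
      using measurable_card_Int_pair by auto
    have *: "{p \<in> space ?M. card (fst p \<inter> U) = 0} \<in> sets ?M" "{p \<in> space ?M. snd p \<in> U} \<in> sets ?M"
      by (intro sets_Collect_nat_eq) measurable
    show "S \<in> sets ?M"
      unfolding S by (intro sets.sets_Collect_conj *)
  qed fact
  finally show ?thesis
    by (simp add: pred_def)
qed

text \<open>The count in U grows by one exactly when the new point lies in U and not yet in the
  configuration; measurability of the membership relation settles the second condition.\<close>

lemma measurable_insert_config: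
  "(\<lambda>p. fst p \<union> {snd p}) \<in>
     measurable (config_borel \<Otimes>\<^sub>M (borel :: 'a::{second_countable_topology, t2_space} measure)) config_borel"
proof (rule measurable_config_borelI)
  let ?M = "config_borel \<Otimes>\<^sub>M (borel :: 'a measure)"
  show "(\<lambda>p. fst p \<union> {snd p}) \<in> space ?M \<rightarrow> finite_configs"
    by (auto simp: space_pair_measure space_config_borel finite_configs_eq)
  fix U :: "'a set" assume "open U"
  then have [measurable]: "U \<in> sets borel"
      "(\<lambda>p. card (fst p \<inter> U)) \<in> measurable ?M (count_space UNIV)"
    using measurable_card_Int_pair by auto
  note pred_mem_config[measurable]
  have "(\<lambda>p. card (fst p \<inter> U) + (if snd p \<in> U \<and> snd p \<notin> fst p then 1 else 0))
      \<in> measurable ?M (count_space UNIV)"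
    by measurable
  also have "?this \<longleftrightarrow> (\<lambda>p. card ((fst p \<union> {snd p}) \<inter> U)) \<in> measurable ?M (count_space UNIV)"
    by (rule measurable_cong)
       (auto simp: card_insert_Int space_pair_measure space_config_borel finite_configs_eq)
  finally show "(\<lambda>p. card ((fst p \<union> {snd p}) \<inter> U)) \<in> measurable ?M (count_space UNIV)" .
qed

lemma measurable_remove_config:
  "(\<lambda>p. fst p - {snd p}) \<in>
     measurable (config_borel \<Otimes>\<^sub>M (borel :: 'a::{second_countable_topology, t2_space} measure)) config_borel"
proof (rule measurable_config_borelI)
  let ?M = "config_borel \<Otimes>\<^sub>M (borel :: 'a measure)"
  show "(\<lambda>p. fst p - {snd p}) \<in> space ?M \<rightarrow> finite_configs"
    by (auto simp: space_pair_measure space_config_borel finite_configs_eq)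
  fix U :: "'a set" assume "open U"
  then have [measurable]: "U \<in> sets borel"
      "(\<lambda>p. card (fst p \<inter> U)) \<in> measurable ?M (count_space UNIV)"
    using measurable_card_Int_pair by auto
  note pred_mem_config[measurable]
  show "(\<lambda>p. card ((fst p - {snd p}) \<inter> U)) \<in> measurable ?M (count_space UNIV)"
    unfolding card_remove_Int by measurable
qed

text \<open>
  On a cell, the points of a configuration can be listed measurably, one for each of the disjoint
  open sets; this turns sums over the points into sums over a fixed finite index set.
\<close>

lemma measurable_sum_config:
  fixes H :: "'a::{second_countable_topology, t2_space} set \<times> 'a \<Rightarrow> complex"
  assumes H: "H \<in> borel_measurable (config_borel \<Otimes>\<^sub>M borel)"
  shows "(\<lambda>\<eta>. \<Sum>x\<in>\<eta>. H (\<eta>, x)) \<in> borel_measurable config_borel"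
proof -
  obtain \<B> :: "'a set set" where \<B>: "countable \<B>" "topological_basis \<B>"
    by (rule ex_countable_topological_basis)
  have op: "open U" if "\<U> \<in> cells \<B>" "U \<in> \<U>" for \<U> U
    using that topological_basis_open[OF \<B>(2)] by (auto simp: cells_def)
  have cell: "cell \<U> \<in> sets config_borel" if "\<U> \<in> cells \<B>" for \<U>
    using that op by (intro cell_in_sets_config_borel) (auto simp: cells_def)
  show ?thesis
  proof (rule measurable_piecewise_restrict[of "cell ` cells \<B>"])
    show "countable (cell ` cells \<B>)"
      using countable_cells[OF \<B>(1)] by simp
    show "\<Omega> \<inter> space config_borel \<in> sets config_borel" if "\<Omega> \<in> cell ` cells \<B>" for \<Omega>
      using that cell by auto
    show "space config_borel \<subseteq> \<Union> (cell ` cells \<B>)"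
    proof
      fix \<eta> :: "'a set" assume "\<eta> \<in> space config_borel"
      \<comment> \<open>The whole space is written as an open superlevel set with k = 0, so that
        \<open>cell_neighbourhood\<close> provides the covering by cells.\<close>
      then have "\<eta> \<in> {\<eta> \<in> finite_configs. 0 \<le> card (\<eta> \<inter> UNIV)}"
        by (simp add: space_config_borel)
      from cell_neighbourhood[OF \<B>(2) openin_card_Int_ge[OF open_UNIV] this]
      show "\<eta> \<in> \<Union> (cell ` cells \<B>)" by blast
    qed
    fix \<Omega> assume "\<Omega> \<in> cell ` cells \<B>"
    then obtain \<U> where \<U>: "\<U> \<in> cells \<B>" "\<Omega> = cell \<U>" by auto
    let ?R = "restrict_space config_borel \<Omega>"
    have space_R: "space ?R = \<Omega>"
      using cell[OF \<U>(1)] \<U>(2) sets.sets_into_space by (auto simp: space_restrict_space)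
    define s where "s U \<eta> = (THE x. x \<in> \<eta> \<inter> U)" for U \<eta> :: "'a set"
    have s: "\<eta> \<inter> U = {s U \<eta>}" if "\<eta> \<in> \<Omega>" "U \<in> \<U>" for U \<eta>
    proof -
      have "card (\<eta> \<inter> U) = 1"
        using that \<U>(2) by (simp add: cell_def)
      then obtain y where "\<eta> \<inter> U = {y}"
        by (rule card_1_singletonE)
      then show ?thesis
        by (simp add: s_def)
    qed
    have s_meas: "s U \<in> borel_measurable ?R" if "U \<in> \<U>" for U
    proof (rule borel_measurableI)
      fix V :: "'a set" assume "open V"
      then have "(\<lambda>\<eta>. card (\<eta> \<inter> (U \<inter> V))) \<in> measurable ?R (count_space UNIV)"
        using op[OF \<U>(1) that] by (intro measurable_restrict_space1 measurable_card_Int) auto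
      then have "{\<eta> \<in> space ?R. card (\<eta> \<inter> (U \<inter> V)) = 1} \<in> sets ?R"
        by (rule sets_Collect_nat_eq) simp
      also have "{\<eta> \<in> space ?R. card (\<eta> \<inter> (U \<inter> V)) = 1} = s U -` V \<inter> space ?R"
      proof -
        \<comment> \<open>As \<eta> has just one point in U, its position relative to V is read off
          from the count in \<open>U \<inter> V\<close>.\<close>
        have "card (\<eta> \<inter> (U \<inter> V)) = 1 \<longleftrightarrow> s U \<eta> \<in> V" if "\<eta> \<in> \<Omega>" for \<eta>
        proof -
          have "\<eta> \<inter> (U \<inter> V) = {s U \<eta>} \<inter> V"
            using s[OF that \<open>U \<in> \<U>\<close>] by auto
          then show ?thesis
            by (cases "s U \<eta> \<in> V") simp_all
        qed
        then show ?thesis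
          unfolding space_R by auto
      qed
      finally show "s U -` V \<inter> space ?R \<in> sets ?R" .
    qed
    have "(\<lambda>\<eta>. \<Sum>U\<in>\<U>. H (\<eta>, s U \<eta>)) \<in> borel_measurable ?R"
    proof (rule borel_measurable_sum)
      fix U assume "U \<in> \<U>"
      have "(\<lambda>\<eta>. (\<eta>, s U \<eta>)) \<in> measurable ?R (config_borel \<Otimes>\<^sub>M borel)"
        using s_meas[OF \<open>U \<in> \<U>\<close>]
        by (intro measurable_Pair) (simp_all add: measurable_restrict_space1)
      then show "(\<lambda>\<eta>. H (\<eta>, s U \<eta>)) \<in> borel_measurable ?R"
        using H by (rule measurable_compose)
    qed
    also have "?this \<longleftrightarrow> (\<lambda>\<eta>. \<Sum>x\<in>\<eta>. H (\<eta>, x)) \<in> borel_measurable ?R"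
    proof (rule measurable_cong)
      fix \<eta> assume "\<eta> \<in> space ?R"
      then have \<eta>: "\<eta> \<in> \<Omega>" by (simp add: space_R)
      have "\<eta> = (\<Union>U\<in>\<U>. \<eta> \<inter> U)"
        using \<eta> \<U>(2) unfolding cell_def by blast
      also have "\<dots> = (\<Union>U\<in>\<U>. {s U \<eta>})"
        using s[OF \<eta>] by simp
      finally have img: "(\<lambda>U. s U \<eta>) ` \<U> = \<eta>"
        by (simp add: UNION_singleton_eq_range)
      have "inj_on (\<lambda>U. s U \<eta>) \<U>"
      proof (rule inj_onI)
        fix U V assume UV: "U \<in> \<U>" "V \<in> \<U>" "s U \<eta> = s V \<eta>"
        then have "s U \<eta> \<in> U \<inter> V"
          using s[OF \<eta>, of U] s[OF \<eta>, of V] by auto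
        moreover have "disjoint \<U>"
          using \<U>(1) by (simp add: cells_def)
        ultimately show "U = V"
          using UV disjointD[of \<U> U V] by blast
      qed
      then have "bij_betw (\<lambda>U. s U \<eta>) \<U> \<eta>"
        using img by (simp add: bij_betw_def)
      then show "(\<Sum>U\<in>\<U>. H (\<eta>, s U \<eta>)) = (\<Sum>x\<in>\<eta>. H (\<eta>, x))"
        by (rule sum.reindex_bij_betw)
    qed
    finally show "(\<lambda>\<eta>. \<Sum>x\<in>\<eta>. H (\<eta>, x)) \<in> borel_measurable ?R" .
  qed
qed

section \<open>Bounded functions with bounded support\<close>

lemma measurable_card_config: "card \<in> measurable config_borel (count_space UNIV)"
  using measurable_card_Int[OF open_UNIV] by simp

text \<open>The bounding Borel set is replaced by its compact closure, and vanishing outside is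
  turned into a condition on nonzero values, the form in which supports are tracked. The sign of C
  comes from the bound at the empty configuration.\<close>

lemma B_bsE:
  fixes G :: "'a::t2_space set \<Rightarrow> complex"
  assumes "G \<in> B_bs"
  obtains K C N where "G \<in> borel_measurable config_borel" "compact K"
    "\<forall>\<eta>\<in>finite_configs. cmod (G \<eta>) \<le> C" "0 \<le> C"
    "\<forall>\<eta>\<in>finite_configs. G \<eta> \<noteq> 0 \<longrightarrow> \<eta> \<subseteq> K \<and> card \<eta> \<le> N"
proof -
  from assms obtain C N \<Lambda> where *: "G \<in> borel_measurable config_borel"
    "\<forall>\<eta>\<in>finite_configs. cmod (G \<eta>) \<le> C" "compact (closure \<Lambda>)"
    "\<forall>\<eta>\<in>finite_configs. \<eta> \<notin> (\<Union>n\<le>N. n_configs \<Lambda> n) \<longrightarrow> G \<eta> = 0"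
    unfolding B_bs_def by blast
  show ?thesis
  proof (rule that[OF *(1,3,2)])
    have "{} \<in> finite_configs"
      by (simp add: finite_configs_eq)
    then show "0 \<le> C"
      using *(2) norm_ge_zero order_trans by blast
    show "\<forall>\<eta>\<in>finite_configs. G \<eta> \<noteq> 0 \<longrightarrow> \<eta> \<subseteq> closure \<Lambda> \<and> card \<eta> \<le> N"
    proof (intro ballI impI)
      fix \<eta> assume "\<eta> \<in> finite_configs" "G \<eta> \<noteq> 0"
      then have "\<eta> \<in> (\<Union>n\<le>N. n_configs \<Lambda> n)"
        using *(4) by blast
      then show "\<eta> \<subseteq> closure \<Lambda> \<and> card \<eta> \<le> N"
        using closure_subset[of \<Lambda>] by (auto simp: n_configs_def)
    qed
  qed
qed

lemma B_bsI:
  fixes G :: "'a::t2_space set \<Rightarrow> complex"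
  assumes "G \<in> borel_measurable config_borel" "compact K"
    and "\<And>\<eta>. \<eta> \<in> finite_configs \<Longrightarrow> cmod (G \<eta>) \<le> C"
    and supp: "\<And>\<eta>. \<eta> \<in> finite_configs \<Longrightarrow> G \<eta> \<noteq> 0 \<Longrightarrow> \<eta> \<subseteq> K \<and> card \<eta> \<le> N"
  shows "G \<in> B_bs"
proof -
  have "K \<in> sets borel" "closure K = K"
    using \<open>compact K\<close> by (simp_all add: borel_compact compact_imp_closed)
  moreover have "G \<eta> = 0" if "\<eta> \<in> finite_configs" "\<eta> \<notin> (\<Union>n\<le>N. n_configs K n)" for \<eta>
    using supp[OF that(1)] that by (auto simp: n_configs_def finite_configs_eq)
  ultimately have "K \<in> sets borel \<and> compact (closure K) \<and>
      (\<forall>\<eta>\<in>finite_configs. \<eta> \<notin> (\<Union>n\<le>N. n_configs K n) \<longrightarrow> G \<eta> = 0)"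
    using \<open>compact K\<close> by simp
  then show ?thesis
    using assms(1,3) unfolding B_bs_def by blast
qed

text \<open>On the support of G only cardinalities up to N occur, so the factor is bounded there
  however fast c grows.\<close>

lemma B_bs_mult_card:
  fixes G :: "'a::t2_space set \<Rightarrow> complex"
  assumes "G \<in> B_bs"
  shows "(\<lambda>\<eta>. c (card \<eta>) * G \<eta>) \<in> B_bs"
proof -
  obtain K C N where G_bs: "G \<in> borel_measurable config_borel" "compact K"
    "\<forall>\<eta>\<in>finite_configs. cmod (G \<eta>) \<le> C" "0 \<le> C"
    "\<forall>\<eta>\<in>finite_configs. G \<eta> \<noteq> 0 \<longrightarrow> \<eta> \<subseteq> K \<and> card \<eta> \<le> N"
    using assms by (rule B_bsE)
  note G = G_bs[rule_format]
  show ?thesis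
  proof (rule B_bsI[where K = K and C = "(\<Sum>n\<le>N. cmod (c n)) * C" and N = N])
    have "(\<lambda>\<eta>. c (card \<eta>)) \<in> borel_measurable config_borel"
      using measurable_card_config by (rule measurable_compose) simp
    then show "(\<lambda>\<eta>. c (card \<eta>) * G \<eta>) \<in> borel_measurable config_borel"
      using G(1) by (rule borel_measurable_times)
    show "cmod (c (card \<eta>) * G \<eta>) \<le> (\<Sum>n\<le>N. cmod (c n)) * C" if \<eta>: "\<eta> \<in> finite_configs" for \<eta>
    proof (cases "G \<eta> = 0")
      case True
      then show ?thesis
        using G(4) by (simp add: sum_nonneg)
    next
      case False
      then have "card \<eta> \<in> {..N}"
        using G(5)[OF \<eta>] by simp
      then have "cmod (c (card \<eta>)) \<le> (\<Sum>n\<le>N. cmod (c n))"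
        by (intro member_le_sum) auto
      then show ?thesis
        unfolding norm_mult using G(3)[OF \<eta>] by (intro mult_mono) (auto simp: sum_nonneg)
    qed
    show "\<eta> \<subseteq> K \<and> card \<eta> \<le> N" if "\<eta> \<in> finite_configs" "c (card \<eta>) * G \<eta> \<noteq> 0" for \<eta>
      using G(5) that by simp
  qed fact
qed

lemma measurable_annihilation_integrand:
  fixes G :: "'a::{second_countable_topology, t2_space} set \<Rightarrow> complex"
  assumes G: "G \<in> borel_measurable config_borel" and \<phi>: "\<phi> \<in> borel_measurable borel"
  shows "(\<lambda>p. G (fst p \<union> {snd p}) * \<phi> (snd p)) \<in> borel_measurable (config_borel \<Otimes>\<^sub>M borel)"
proof (rule borel_measurable_times)
  show "(\<lambda>p. G (fst p \<union> {snd p})) \<in> borel_measurable (config_borel \<Otimes>\<^sub>M borel)"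
    using measurable_insert_config G by (rule measurable_compose)
  show "(\<lambda>p. \<phi> (snd p)) \<in> borel_measurable (config_borel \<Otimes>\<^sub>M borel)"
    using measurable_snd \<phi> by (rule measurable_compose)
qed

text \<open>A nonzero integral at \<eta> forces \<open>G (\<eta> \<union> {x})\<close> to be nonzero
  for some x, so \<eta> inherits the bounds K and N. The size is at most C times the integral of
  \<open>cmod (\<phi> x)\<close>, and sigma-finiteness makes the integral measurable in
  \<eta>.\<close>

lemma annihilation_in_B_bs:
  fixes G :: "'a::{second_countable_topology, t2_space} set \<Rightarrow> complex"
  assumes \<mu>: "sigma_finite_measure \<mu>" "sets \<mu> = sets borel"
    and \<phi>: "integrable \<mu> \<phi>" and "G \<in> B_bs"
  shows "annihilation \<mu> \<phi> G \<in> B_bs"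
proof -
  interpret sigma_finite_measure \<mu> by fact
  obtain K C N where G_bs: "G \<in> borel_measurable config_borel" "compact K"
    "\<forall>\<eta>\<in>finite_configs. cmod (G \<eta>) \<le> C" "0 \<le> C"
    "\<forall>\<eta>\<in>finite_configs. G \<eta> \<noteq> 0 \<longrightarrow> \<eta> \<subseteq> K \<and> card \<eta> \<le> N"
    using \<open>G \<in> B_bs\<close> by (rule B_bsE)
  note G = G_bs[rule_format]
  show ?thesis
  proof (rule B_bsI[where K = K and C = "\<integral>x. C * cmod (\<phi> x) \<partial>\<mu>" and N = N])
    have "\<phi> \<in> borel_measurable borel"
      using borel_measurable_integrable[OF \<phi>] measurable_cong_sets[OF \<mu>(2) refl] by blast
    then have "(\<lambda>p. G (fst p \<union> {snd p}) * \<phi> (snd p)) \<in> borel_measurable (config_borel \<Otimes>\<^sub>M borel)"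
      by (rule measurable_annihilation_integrand[OF G(1)])
    then have "(\<lambda>(\<eta>, x). G (\<eta> \<union> {x}) * \<phi> x) \<in> borel_measurable (config_borel \<Otimes>\<^sub>M \<mu>)"
      using measurable_cong_sets[OF sets_pair_measure_cong[OF refl \<mu>(2)] refl]
      by (auto simp: case_prod_unfold)
    then show "annihilation \<mu> \<phi> G \<in> borel_measurable config_borel"
      unfolding annihilation_def by (rule borel_measurable_lebesgue_integral)
    show "cmod (annihilation \<mu> \<phi> G \<eta>) \<le> (\<integral>x. C * cmod (\<phi> x) \<partial>\<mu>)" if \<eta>: "\<eta> \<in> finite_configs" for \<eta>
    proof -
      have "cmod (annihilation \<mu> \<phi> G \<eta>) \<le> (\<integral>x. cmod (G (\<eta> \<union> {x}) * \<phi> x) \<partial>\<mu>)"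
        unfolding annihilation_def by (rule integral_norm_bound)
      also have "\<dots> \<le> (\<integral>x. C * cmod (\<phi> x) \<partial>\<mu>)"
      proof (rule integral_mono')
        show "integrable \<mu> (\<lambda>x. C * cmod (\<phi> x))"
          using \<phi> by simp
        show "cmod (G (\<eta> \<union> {x}) * \<phi> x) \<le> C * cmod (\<phi> x)" for x
          using G(3)[of "\<eta> \<union> {x}"] \<eta> by (simp add: norm_mult mult_right_mono finite_configs_eq)
      qed (use G(4) in simp)
      finally show ?thesis .
    qed
    show "\<eta> \<subseteq> K \<and> card \<eta> \<le> N" if \<eta>: "\<eta> \<in> finite_configs" and nz: "annihilation \<mu> \<phi> G \<eta> \<noteq> 0" for \<eta>
    proof -
      obtain x where "G (\<eta> \<union> {x}) \<noteq> 0"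
        using nz unfolding annihilation_def by fastforce
      then have "\<eta> \<union> {x} \<subseteq> K" "card (\<eta> \<union> {x}) \<le> N"
        using G(5)[of "\<eta> \<union> {x}"] \<eta> by (simp_all add: finite_configs_eq)
      moreover have "card \<eta> \<le> card (\<eta> \<union> {x})"
        using \<eta> by (intro card_mono) (auto simp: finite_configs_eq)
      ultimately show ?thesis by auto
    qed
  qed fact
qed

lemma creation_in_B_bs:
  fixes G :: "'a::{second_countable_topology, t2_space} set \<Rightarrow> complex"
  assumes \<phi>: "\<phi> \<in> borel_measurable borel" "compact L" "\<And>x. \<phi> x \<noteq> 0 \<Longrightarrow> x \<in> L"
      "\<And>x. cmod (\<phi> x) \<le> D"
    and "G \<in> B_bs"
  shows "creation \<phi> G \<in> B_bs"
proof -
  obtain K C N where G_bs: "G \<in> borel_measurable config_borel" "compact K"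
    "\<forall>\<eta>\<in>finite_configs. cmod (G \<eta>) \<le> C" "0 \<le> C"
    "\<forall>\<eta>\<in>finite_configs. G \<eta> \<noteq> 0 \<longrightarrow> \<eta> \<subseteq> K \<and> card \<eta> \<le> N"
    using \<open>G \<in> B_bs\<close> by (rule B_bsE)
  note G = G_bs[rule_format]
  \<comment> \<open>A nonzero sum has a nonzero term, whose removed point lies in L. The resulting
    cardinality bound also limits the number of summands in the norm estimate.\<close>
  have supp: "\<eta> \<subseteq> K \<union> L \<and> card \<eta> \<le> Suc N"
    if \<eta>: "\<eta> \<in> finite_configs" and nz: "creation \<phi> G \<eta> \<noteq> 0" for \<eta>
  proof -
    obtain x where x: "x \<in> \<eta>" "G (\<eta> - {x}) * \<phi> x \<noteq> 0"
      using nz sum.neutral[of \<eta> "\<lambda>x. G (\<eta> - {x}) * \<phi> x"] unfolding creation_def by blast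
    then have "\<eta> - {x} \<subseteq> K" "card (\<eta> - {x}) \<le> N" "x \<in> L"
      using G(5)[of "\<eta> - {x}"] \<phi>(3)[of x] \<eta> by (simp_all add: finite_configs_eq)
    with x(1) show ?thesis
      by (auto simp: card_Diff_singleton)
  qed
  have D: "0 \<le> D"
    using \<phi>(4) norm_ge_zero order_trans by blast
  show ?thesis
  \<comment> \<open>At most N + 1 summands, each of modulus at most C D.\<close>
  proof (rule B_bsI[where K = "K \<union> L" and C = "Suc N * (C * D)" and N = "Suc N"])
    have "(\<lambda>p. G (fst p - {snd p}) * \<phi> (snd p)) \<in> borel_measurable (config_borel \<Otimes>\<^sub>M borel)"
    proof (rule borel_measurable_times)
      show "(\<lambda>p. G (fst p - {snd p})) \<in> borel_measurable (config_borel \<Otimes>\<^sub>M borel)"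
        using measurable_remove_config G(1) by (rule measurable_compose)
      show "(\<lambda>p. \<phi> (snd p)) \<in> borel_measurable (config_borel \<Otimes>\<^sub>M borel)"
        using measurable_snd \<phi>(1) by (rule measurable_compose)
    qed
    from measurable_sum_config[OF this]
    show "creation \<phi> G \<in> borel_measurable config_borel"
      by (simp add: creation_def[abs_def])
    show "compact (K \<union> L)"
      using G(2) \<phi>(2) by (rule compact_Un)
    show "cmod (creation \<phi> G \<eta>) \<le> Suc N * (C * D)" if \<eta>: "\<eta> \<in> finite_configs" for \<eta>
    proof (cases "creation \<phi> G \<eta> = 0")
      case True
      then show ?thesis
        using G(4) D by simp
    next
      case False
      have "cmod (creation \<phi> G \<eta>) \<le> of_nat (card \<eta>) * (C * D)"
        unfolding creation_def
      proof (rule sum_norm_bound)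
        fix x
        have "cmod (G (\<eta> - {x})) \<le> C"
          using G(3) \<eta> by (simp add: finite_configs_eq)
        then show "cmod (G (\<eta> - {x}) * \<phi> x) \<le> C * D"
          unfolding norm_mult using \<phi>(4)[of x] G(4) by (intro mult_mono) auto
      qed
      also have "\<dots> \<le> Suc N * (C * D)"
        using supp[OF \<eta> False] G(4) D by (intro mult_right_mono) auto
      finally show ?thesis .
    qed
  qed (rule supp)
qed

section \<open>Finite measure of bounded sets of configurations, and square integrability\<close>

lemma off_diag_in_sets_PiM:
  assumes "sets \<mu> = sets (borel :: 'a::{second_countable_topology, t2_space} measure)"
  shows "off_diag n \<in> sets (PiM {..<n} (\<lambda>_. \<mu>))"
proof -
  let ?M = "PiM {..<n} (\<lambda>_. \<mu>)"
  have sp: "space \<mu> = UNIV"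
    using sets_eq_imp_space_eq[OF assms] by simp
  have comp: "(\<lambda>x. x i) \<in> borel_measurable ?M" if "i < n" for i
  proof -
    have "(\<lambda>x. x i) \<in> measurable ?M \<mu>"
      using that by (intro measurable_component_singleton) simp
    then show ?thesis
      using measurable_cong_sets[OF refl assms] by blast
  qed
  have "off_diag n = {x \<in> space ?M. \<forall>i\<in>{..<n}. \<forall>j\<in>{..<n}. x i = x j \<longrightarrow> i = j}"
    by (auto simp: off_diag_def space_PiM sp inj_on_def)
  \<comment> \<open>Moving the condition on the indices into the range of j leaves a finite
    conjunction of negated equalities between measurable coordinates.\<close>
  also have "\<dots> = {x \<in> space ?M. \<forall>i\<in>{..<n}. \<forall>j\<in>{..<n} - {i}. \<not> x i = x j}"
    by auto
  also have "\<dots> \<in> sets ?M"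
    by (intro sets.sets_Collect_finite_All sets.sets_Collect_neg measurable_equality_set comp) auto
  finally show ?thesis .
qed

text \<open>For an injective tuple, the number of points in U is the sum of the indicators of U at
  the coordinates. Measurability is what allows \<open>n_config_measure\<close> to be evaluated
  through \<open>emeasure_distr\<close>.\<close>

lemma measurable_sym_map:
  assumes "sets \<mu> = sets (borel :: 'a::{second_countable_topology, t2_space} measure)"
  shows "sym_map n \<in> measurable (restrict_space (PiM {..<n} (\<lambda>_. \<mu>)) (off_diag n)) config_borel"
proof (rule measurable_config_borelI)
  let ?M = "PiM {..<n} (\<lambda>_. \<mu>)"
  let ?R = "restrict_space ?M (off_diag n)"
  show "sym_map n \<in> space ?R \<rightarrow> finite_configs"
    by (auto simp: sym_map_def finite_configs_eq)
  fix U :: "'a set" assume "open U"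
  then have U: "U \<in> sets \<mu>"
    using assms by simp
  have "(\<lambda>x. \<Sum>i<n. indicator U (x i) :: nat) \<in> borel_measurable ?M"
  proof (rule borel_measurable_sum)
    fix i assume "i \<in> {..<n}"
    then have "(\<lambda>x. x i) \<in> measurable ?M \<mu>"
      by (rule measurable_component_singleton)
    then show "(\<lambda>x. indicator U (x i) :: nat) \<in> borel_measurable ?M"
      by (rule measurable_compose) (use U in \<open>rule borel_measurable_indicator\<close>)
  qed
  then have "(\<lambda>x. \<Sum>i<n. indicator U (x i) :: nat) \<in> borel_measurable ?R"
    by (rule measurable_restrict_space1)
  then have "(\<lambda>x. \<Sum>i<n. indicator U (x i) :: nat) \<in> measurable ?R (count_space UNIV)"
    using measurable_cong_sets[OF refl sets_borel_eq_count_space] by blast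
  also have "?this \<longleftrightarrow> (\<lambda>x. card (sym_map n x \<inter> U)) \<in> measurable ?R (count_space UNIV)"
  proof (rule measurable_cong)
    fix x assume "x \<in> space ?R"
    then have inj: "inj_on x {..<n}"
      by (simp add: space_restrict_space off_diag_def)
    have "card (sym_map n x \<inter> U) = (\<Sum>y\<in>x ` {..<n}. indicator U y)"
      by (simp add: sym_map_def sum_indicator_eq_card)
    also have "\<dots> = (\<Sum>i<n. indicator U (x i))"
      using sum.reindex[OF inj] by simp
    finally show "(\<Sum>i<n. indicator U (x i)) = card (sym_map n x \<inter> U)" by simp
  qed
  finally show "(\<lambda>x. card (sym_map n x \<inter> U)) \<in> measurable ?R (count_space UNIV)" .
qed

text \<open>Lying in K means having no point in the open complement, which is a counting
  condition.\<close>

lemma bounded_configs_in_sets: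
  assumes "compact (K :: 'a::t2_space set)"
  shows "{\<eta> \<in> finite_configs. \<eta> \<subseteq> K \<and> card \<eta> \<le> N} \<in> sets config_borel"
proof -
  have "open (- K)"
    using assms by (simp add: compact_imp_closed open_Compl)
  then have "{\<eta> \<in> space config_borel. card (\<eta> \<inter> - K) = 0} \<inter>
      (card -` {..N} \<inter> space config_borel) \<in> sets config_borel"
    by (intro sets.Int sets_Collect_nat_eq measurable_card_Int
        measurable_sets[OF measurable_card_config]) auto
  also have "{\<eta> \<in> space config_borel. card (\<eta> \<inter> - K) = 0} \<inter> (card -` {..N} \<inter> space config_borel)
      = {\<eta> \<in> finite_configs. \<eta> \<subseteq> K \<and> card \<eta> \<le> N}"
    by (auto simp: space_config_borel finite_configs_eq)
  finally show ?thesis .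
qed

text \<open>Only the levels n up to N contribute, and the n-th one has measure at most the n-th
  power of that of K, since tuples with all points in K lie in the corresponding box.\<close>

lemma emeasure_bounded_configs:
  fixes \<mu> :: "'a::{second_countable_topology, t2_space} measure"
  assumes \<mu>: "sigma_finite_measure \<mu>" "sets \<mu> = sets borel"
    and K: "compact K" "emeasure \<mu> K < \<infinity>"
  shows "emeasure (weighted_config_measure w \<mu>) {\<eta> \<in> finite_configs. \<eta> \<subseteq> K \<and> card \<eta> \<le> N} < \<infinity>"
    (is "emeasure _ ?S < _")
proof -
  interpret product_sigma_finite "\<lambda>_. \<mu>"
    by (simp add: product_sigma_finite_def \<mu>(1))
  have S: "?S \<in> sets config_borel"
    by (rule bounded_configs_in_sets) fact
  let ?M = "\<lambda>n. PiM {..<n} (\<lambda>_. \<mu>)"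
  let ?P = "\<lambda>n. sym_map n -` ?S \<inter> space (restrict_space (?M n) (off_diag n))"
  have e: "emeasure (n_config_measure \<mu> n) ?S = emeasure (?M n) (?P n)" for n
  proof -
    have "emeasure (n_config_measure \<mu> n) ?S = emeasure (restrict_space (?M n) (off_diag n)) (?P n)"
      unfolding n_config_measure_def using measurable_sym_map[OF \<mu>(2)] S by (rule emeasure_distr)
    also have "\<dots> = emeasure (?M n) (?P n)"
      using off_diag_in_sets_PiM[OF \<mu>(2)]
      by (intro emeasure_restrict_space) (auto simp: space_restrict_space)
    finally show ?thesis .
  qed
  have fin: "emeasure (n_config_measure \<mu> n) ?S < \<infinity>" for n
  proof -
    have KM: "K \<in> sets \<mu>"
      using K(1) \<mu>(2) by (simp add: borel_compact)
    have "emeasure (?M n) (?P n) \<le> emeasure (?M n) (Pi\<^sub>E {..<n} (\<lambda>_. K))"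
      using KM by (intro emeasure_mono sets_PiM_I_finite)
        (auto simp: space_restrict_space off_diag_def sym_map_def image_subset_iff)
    also have "\<dots> = emeasure \<mu> K ^ n"
      using KM by (subst emeasure_PiM) auto
    also have "\<dots> < \<infinity>"
      using K(2) by (simp add: power_less_top_ennreal)
    finally show ?thesis
      by (simp add: e)
  qed
  have zero: "emeasure (n_config_measure \<mu> n) ?S = 0" if "n \<notin> {..N}" for n
  proof -
    have "?P n = {}"
      using that by (auto simp: space_restrict_space off_diag_def sym_map_def card_image)
    then show ?thesis
      by (simp add: e)
  qed
  have "emeasure (weighted_config_measure w \<mu>) ?S
      = (\<Sum>n\<le>N. ennreal (w n) * emeasure (n_config_measure \<mu> n) ?S)"
    unfolding emeasure_weighted_config_measure[OF S]
    by (rule suminf_finite) (simp_all add: zero)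
  also have "\<dots> < \<infinity>"
    using fin by (simp add: ennreal_mult_less_top)
  finally show ?thesis .
qed

text \<open>A bounded measurable function vanishing off a set of finite measure is square
  integrable. With w arbitrary, this covers \<open>lambda_mu\<close> and
  \<open>lambda_mu_frac\<close> at once.\<close>

lemma B_bs_subset_L2:
  fixes \<mu> :: "'a::{second_countable_topology, t2_space} measure"
  assumes \<mu>: "sigma_finite_measure \<mu>" "sets \<mu> = sets borel"
    and fin: "\<And>K. compact K \<Longrightarrow> emeasure \<mu> K < \<infinity>"
  shows "B_bs \<subseteq> L2 (weighted_config_measure w \<mu>)"
proof
  fix G :: "'a set \<Rightarrow> complex" assume "G \<in> B_bs"
  then obtain K C N where G_bs: "G \<in> borel_measurable config_borel" "compact K"
    "\<forall>\<eta>\<in>finite_configs. cmod (G \<eta>) \<le> C" "0 \<le> C"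
    "\<forall>\<eta>\<in>finite_configs. G \<eta> \<noteq> 0 \<longrightarrow> \<eta> \<subseteq> K \<and> card \<eta> \<le> N"
    by (rule B_bsE)
  note G = G_bs[rule_format]
  let ?W = "weighted_config_measure w \<mu>"
  let ?S = "{\<eta> \<in> finite_configs. \<eta> \<subseteq> K \<and> card \<eta> \<le> N}"
  have meas: "G \<in> borel_measurable ?W"
    using G(1) measurable_cong_sets[OF sets_weighted_config_measure refl] by blast
  moreover have "integrable ?W (\<lambda>\<eta>. (cmod (G \<eta>))\<^sup>2)"
  proof (rule integrableI_bounded_set)
    show "?S \<in> sets ?W"
      using bounded_configs_in_sets[OF G(2)] by (simp add: sets_weighted_config_measure)
    show "(\<lambda>\<eta>. (cmod (G \<eta>))\<^sup>2) \<in> borel_measurable ?W"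
      using meas by measurable
    show "emeasure ?W ?S < \<infinity>"
      using emeasure_bounded_configs[OF \<mu> G(2) fin[OF G(2)]] .
    show "AE \<eta> in ?W. \<eta> \<in> ?S \<longrightarrow> norm ((cmod (G \<eta>))\<^sup>2) \<le> C\<^sup>2"
      using G(3) by (intro AE_I2) (simp add: power_mono)
    show "AE \<eta> in ?W. \<eta> \<notin> ?S \<longrightarrow> (cmod (G \<eta>))\<^sup>2 = 0"
      using G(5) by (intro AE_I2) (auto simp: space_weighted_config_measure)
  qed
  ultimately show "G \<in> L2 ?W"
    by (simp add: L2_def)
qed

section \<open>The manifold and the transported operators\<close>

lemma smooth_function_continuous:
  assumes A: "smooth_atlas A" and \<phi>: "smooth_function A \<phi>"
  shows "continuous_on UNIV \<phi>"
proof -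
  have "continuous_on (dom_of c) \<phi>" if c: "c \<in> A" for c
  proof -
    obtain h where h: "homeomorphism (dom_of c) (coord c ` dom_of c) (coord c) h"
      using A c by (auto simp: smooth_atlas_def is_chart_def)
    let ?f = "\<phi> \<circ> inv_into (dom_of c) (coord c)"
    have "Ck_on 0 ?f (coord c ` dom_of c)"
      using \<phi> c by (simp only: smooth_function_def smooth_on_def)
    then have "continuous_on (dom_of c) (?f \<circ> coord c)"
      using homeomorphism_cont1[OF h] by (intro continuous_on_compose[of _ "coord c"]) (simp_all only: Ck_on.simps)
    then show ?thesis
    proof (rule continuous_on_eq)
      have "inj_on (coord c) (dom_of c)"
        using homeomorphism_apply1[OF h] by (rule inj_on_inverseI)
      then show "(?f \<circ> coord c) x = \<phi> x" if "x \<in> dom_of c" for x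
        using that by simp
    qed
  qed
  moreover have "open (dom_of c)" if "c \<in> A" for c
    using A that by (auto simp: smooth_atlas_def is_chart_def)
  ultimately have "continuous_on (\<Union>c\<in>A. dom_of c) \<phi>"
    by (intro continuous_on_open_UN)
  then show ?thesis
    using A by (simp add: smooth_atlas_def)
qed

text \<open>Pull back a closed ball that fits into the coordinate image: the inverse chart is
  continuous on it, so its image is compact.\<close>

lemma chart_compact_neighbourhood:
  assumes "is_chart c" "p \<in> dom_of c"
  obtains V K where "open V" "p \<in> V" "V \<subseteq> K" "compact K"
proof -
  obtain h where h: "homeomorphism (dom_of c) (coord c ` dom_of c) (coord c) h"
    using assms by (auto simp: is_chart_def)
  obtain r where r: "r > 0" "cball (coord c p) r \<subseteq> coord c ` dom_of c"
    using assms open_contains_cball[of "coord c ` dom_of c"] by (auto simp: is_chart_def)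
  show ?thesis
  proof (rule that)
    have "open (dom_of c)"
      using assms by (simp add: is_chart_def)
    then show "open (coord c -` ball (coord c p) r \<inter> dom_of c)"
      using homeomorphism_cont1[OF h] open_ball by (simp add: continuous_on_open_vimage)
    show "p \<in> coord c -` ball (coord c p) r \<inter> dom_of c"
      using assms r by simp
    show "coord c -` ball (coord c p) r \<inter> dom_of c \<subseteq> h ` cball (coord c p) r"
    proof
      fix q assume q: "q \<in> coord c -` ball (coord c p) r \<inter> dom_of c"
      then have "q = h (coord c q)"
        using homeomorphism_apply1[OF h] by simp
      moreover have "coord c q \<in> cball (coord c p) r"
        using q by simp
      ultimately show "q \<in> h ` cball (coord c p) r"
        by (rule image_eqI)
    qed
    show "compact (h ` cball (coord c p) r)"
      using continuous_on_subset[OF homeomorphism_cont2[OF h] r(2)]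
      by (rule compact_continuous_image) simp
  qed
qed

text \<open>Compact neighbourhoods from the charts give every point an open neighbourhood of finite
  measure; the Lindelof property extracts a countable cover.\<close>

lemma smooth_atlas_sigma_finite:
  fixes \<mu> :: "'a::{second_countable_topology, t2_space} measure"
  assumes A: "smooth_atlas (A :: ('a, 'n::finite) chart set)" and \<mu>: "radon_measure \<mu>"
  shows "sigma_finite_measure \<mu>"
proof
  have sets: "sets \<mu> = sets borel" and fin: "\<And>K. compact K \<Longrightarrow> emeasure \<mu> K < \<infinity>"
    using \<mu> by (auto simp: radon_measure_def)
  let ?F = "{V. open V \<and> emeasure \<mu> V \<noteq> \<infinity>}"
  obtain F' where F': "F' \<subseteq> ?F" "countable F'" "\<Union>F' = \<Union>?F"
    using Lindelof[of ?F] by auto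
  have "p \<in> \<Union>?F" for p
  proof -
    obtain c where "c \<in> A" "p \<in> dom_of c"
      using A unfolding smooth_atlas_def by blast
    then obtain V K where VK: "open V" "p \<in> V" "V \<subseteq> K" "compact K"
      using A chart_compact_neighbourhood unfolding smooth_atlas_def by metis
    then have "emeasure \<mu> V \<le> emeasure \<mu> K"
      by (intro emeasure_mono) (simp_all add: sets borel_compact)
    then have "emeasure \<mu> V < \<infinity>"
      using fin[OF VK(4)] by (rule le_less_trans)
    then show ?thesis
      using VK by auto
  qed
  then have "\<Union>F' = space \<mu>"
    using F'(3) sets_eq_imp_space_eq[OF sets] by auto
  moreover have "F' \<subseteq> sets \<mu>"
    using F'(1) by (auto simp: sets)
  ultimately show "\<exists>A. countable A \<and> A \<subseteq> sets \<mu> \<and> \<Union>A = space \<mu> \<and> (\<forall>a\<in>A. emeasure \<mu> a \<noteq> \<infinity>)"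
    using F'(1,2) by (intro exI[of _ F']) auto
qed

text \<open>A singleton has no subsets besides itself and the empty set, hence none of strictly
  intermediate measure.\<close>

lemma non_atomic_singleton:
  fixes \<mu> :: "'a::t1_space measure"
  assumes "non_atomic \<mu>" "sets \<mu> = sets borel"
  shows "emeasure \<mu> {x} = 0"
proof (rule ccontr)
  assume "emeasure \<mu> {x} \<noteq> 0"
  then have "emeasure \<mu> {x} > 0"
    by (simp add: zero_less_iff_neq_zero)
  then obtain B where B: "B \<subseteq> {x}" "0 < emeasure \<mu> B" "emeasure \<mu> B < emeasure \<mu> {x}"
    using assms unfolding non_atomic_def by (metis borel_singleton sets.empty_sets)
  then have "B = {} \<or> B = {x}"
    by auto
  with B show False by auto
qed

section \<open>Conjugation by the square-root factors\<close>

lemma csqrt_mittag_leffler_deriv0_divide: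
  assumes "\<alpha> > 0"
  shows "csqrt (mittag_leffler_deriv0 \<alpha> m / mittag_leffler_deriv0 \<alpha> n) =
    csqrt (mittag_leffler_deriv0 \<alpha> m) / csqrt (mittag_leffler_deriv0 \<alpha> n)"
proof -
  define r where "r k = fact k / Gamma (\<alpha> * real k + 1)" for k
  have r: "r k > 0" for k
    using assms unfolding r_def by (intro divide_pos_pos Gamma_real_pos) (simp_all add: add_nonneg_pos)
  have E: "mittag_leffler_deriv0 \<alpha> k = of_real (r k)" for k
    using mittag_leffler_deriv0_eq[OF assms] by (simp add: r_def)
  have "csqrt (mittag_leffler_deriv0 \<alpha> m / mittag_leffler_deriv0 \<alpha> n) = csqrt (of_real (r m / r n))"
    by (simp add: E)
  \<comment> \<open>The principal complex square root does not respect quotients in general;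
    positivity of both values reduces the claim to the real square root.\<close>
  also have "\<dots> = of_real (sqrt (r m / r n))"
    using r[of m] r[of n] by (intro of_real_sqrt[symmetric]) simp
  also have "\<dots> = csqrt (of_real (r m)) / csqrt (of_real (r n))"
    using r[of m] r[of n] by (simp add: real_sqrt_divide flip: of_real_sqrt)
  finally show ?thesis
    by (simp add: E)
qed

lemma csqrt_mittag_leffler_deriv0_nonzero:
  assumes "\<alpha> > 0"
  shows "csqrt (mittag_leffler_deriv0 \<alpha> n) \<noteq> 0"
proof -
  have "Gamma (\<alpha> * real n + 1) > 0"
    using assms by (intro Gamma_real_pos) (simp add: add_nonneg_pos)
  then show ?thesis
    by (simp add: mittag_leffler_deriv0_eq[OF assms])
qed

text \<open>The quotient lies in \<open>B_bs\<close>, hence in the domain of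
  \<open>inv_into\<close>, and \<open>I_op\<close> maps it to F. As \<open>I_op\<close> is injective
  pointwise, the chosen preimage is exactly this function, not merely almost everywhere.\<close>

lemma I_op_inv_eq:
  fixes \<mu> :: "'a::t2_space measure"
  assumes "\<alpha> > 0" and L2: "B_bs \<subseteq> L2 (lambda_mu_frac \<alpha> \<mu>)" and "F \<in> B_bs"
  shows "I_op_inv \<alpha> \<mu> F = (\<lambda>\<eta>. F \<eta> / csqrt (mittag_leffler_deriv0 \<alpha> (card \<eta>)))" (is "_ = ?H")
proof -
  note nz = csqrt_mittag_leffler_deriv0_nonzero[OF \<open>\<alpha> > 0\<close>]
  have "(\<lambda>\<eta>. inverse (csqrt (mittag_leffler_deriv0 \<alpha> (card \<eta>))) * F \<eta>) \<in> B_bs"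
    using B_bs_mult_card[OF \<open>F \<in> B_bs\<close>, of "\<lambda>n. inverse (csqrt (mittag_leffler_deriv0 \<alpha> n))"] .
  then have "?H \<in> B_bs"
    by (simp add: divide_inverse mult.commute)
  then have H: "?H \<in> L2 (lambda_mu_frac \<alpha> \<mu>)"
    using L2 by (rule subsetD[rotated])
  have inj: "inj_on (I_op \<alpha>) (L2 (lambda_mu_frac \<alpha> \<mu>))"
  proof (rule inj_onI)
    fix G H :: "'a set \<Rightarrow> complex" assume "I_op \<alpha> G = I_op \<alpha> H"
    then show "G = H"
      using nz by (simp add: I_op_def fun_eq_iff)
  qed
  have "I_op \<alpha> ?H = F"
    using nz by (simp add: I_op_def)
  with inv_into_f_f[OF inj H] show ?thesis
    by (simp only: I_op_inv_def)
qed

text \<open>Off the finite, hence null, set \<eta> the configuration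
  \<open>\<eta> \<union> {x}\<close> has one point more, so the factor is constant almost everywhere
  under the integral. The identity thus holds at every finite configuration.\<close>

lemma annihilation_I_op:
  fixes \<mu> :: "'a::{second_countable_topology, t2_space} measure"
  assumes sets: "sets \<mu> = sets borel" and null: "\<And>x. emeasure \<mu> {x} = 0"
    and \<phi>: "\<phi> \<in> borel_measurable borel" and G: "G \<in> borel_measurable config_borel"
    and \<eta>: "\<eta> \<in> finite_configs"
  shows "annihilation \<mu> \<phi> (I_op \<alpha> G) \<eta> =
    csqrt (mittag_leffler_deriv0 \<alpha> (card \<eta> + 1)) * annihilation \<mu> \<phi> G \<eta>"
proof -
  have fin: "finite \<eta>"
    using \<eta> by (simp add: finite_configs_eq)
  let ?c = "csqrt (mittag_leffler_deriv0 \<alpha> (card \<eta> + 1))"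
  have meas: "(\<lambda>x. F (\<eta> \<union> {x}) * \<phi> x) \<in> borel_measurable \<mu>" if F: "F \<in> borel_measurable config_borel" for F
  proof -
    have "(\<lambda>x. (\<eta>, x)) \<in> measurable borel (config_borel \<Otimes>\<^sub>M borel)"
      using \<eta> by (intro measurable_Pair1') (simp add: space_config_borel)
    from measurable_compose[OF this measurable_annihilation_integrand[OF F \<phi>]]
    have "(\<lambda>x. F (\<eta> \<union> {x}) * \<phi> x) \<in> borel_measurable borel"
      by simp
    then show ?thesis
      using measurable_cong_sets[OF sets refl] by blast
  qed
  have I_meas: "I_op \<alpha> G \<in> borel_measurable config_borel"
    unfolding I_op_def
    using G measurable_compose[OF measurable_card_config, of "\<lambda>n. csqrt (mittag_leffler_deriv0 \<alpha> n)" borel]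
    by (intro borel_measurable_times) simp_all
  have "\<eta> \<in> null_sets \<mu>"
  proof -
    have "(\<Union>x\<in>\<eta>. {x}) \<in> null_sets \<mu>"
      using fin null by (intro null_sets_UN') (auto simp: countable_finite null_sets_def sets)
    then show ?thesis by simp
  qed
  then have "AE x in \<mu>. x \<notin> \<eta>"
    by (rule AE_not_in)
  then have "AE x in \<mu>. I_op \<alpha> G (\<eta> \<union> {x}) * \<phi> x = ?c * (G (\<eta> \<union> {x}) * \<phi> x)"
    by eventually_elim (use fin in \<open>simp add: I_op_def\<close>)
  then have "annihilation \<mu> \<phi> (I_op \<alpha> G) \<eta> = (\<integral>x. ?c * (G (\<eta> \<union> {x}) * \<phi> x) \<partial>\<mu>)"
    unfolding annihilation_def
    by (intro integral_cong_AE meas I_meas borel_measurable_times[OF borel_measurable_const] G)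
  also have "\<dots> = ?c * annihilation \<mu> \<phi> G \<eta>"
    unfolding annihilation_def by simp
  finally show ?thesis .
qed

text \<open>Each removed point belongs to \<eta>, so all terms carry the same factor. At the empty
  configuration the sum is empty and both sides are 0, whatever the truncated
  \<open>card \<eta> - 1\<close> yields.\<close>

lemma creation_I_op:
  assumes "\<eta> \<in> finite_configs"
  shows "creation \<phi> (I_op \<alpha> G) \<eta> =
    csqrt (mittag_leffler_deriv0 \<alpha> (card \<eta> - 1)) * creation \<phi> G \<eta>"
  unfolding creation_def I_op_def sum_distrib_left
  by (rule sum.cong) (simp_all add: card_Diff_singleton)

text \<open>The first three conjuncts record that the composed operators are applied within their
  domains; the last two are the identities themselves.\<close>

theorem proposition5:
  fixes A :: "('a::{second_countable_topology, t2_space}, 'n::finite) chart set"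
    and g :: "('a, 'n) metric"
    and \<mu> :: "'a measure"
    and \<alpha> :: real
    and \<phi> :: "'a \<Rightarrow> complex"
  assumes "oriented_atlas A"
    and "riemannian_metric A g"
    and "geodesically_complete A g"
    and "connected (UNIV :: 'a set)"
    and "\<not> compact (UNIV :: 'a set)"
    and "radon_measure \<mu>"
    and "non_atomic \<mu>"
    and "\<And>U. open U \<Longrightarrow> U \<noteq> {} \<Longrightarrow> emeasure \<mu> U > 0"
    and "emeasure \<mu> UNIV = \<infinity>"
    and "0 < \<alpha>" and "\<alpha> < 1"
    and "\<phi> \<in> test_functions A"
  shows "\<forall>G\<in>B_bs.
      I_op \<alpha> G \<in> B_bs \<and>
      annihilation \<mu> \<phi> (I_op \<alpha> G) \<in> L2 (lambda_mu \<mu>) \<and>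
      creation \<phi> (I_op \<alpha> G) \<in> L2 (lambda_mu \<mu>) \<and>
      L2_eq (lambda_mu_frac \<alpha> \<mu>)
        (annihilation_frac \<alpha> \<mu> \<phi> G)
        (\<lambda>\<eta>. csqrt (mittag_leffler_deriv0 \<alpha> (card \<eta> + 1) / mittag_leffler_deriv0 \<alpha> (card \<eta>)) * annihilation \<mu> \<phi> G \<eta>) \<and>
      L2_eq (lambda_mu_frac \<alpha> \<mu>)
        (creation_frac \<alpha> \<mu> \<phi> G)
        (\<lambda>\<eta>. csqrt (mittag_leffler_deriv0 \<alpha> (card \<eta> - 1) / mittag_leffler_deriv0 \<alpha> (card \<eta>)) * creation \<phi> G \<eta>)"
proof
  fix G :: "'a set \<Rightarrow> complex" assume G: "G \<in> B_bs"
  have atlas: "smooth_atlas A"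
    using assms(1) by (simp add: oriented_atlas_def)
  have sets: "sets \<mu> = sets borel" and fin: "\<And>K. compact K \<Longrightarrow> emeasure \<mu> K < \<infinity>"
    using assms(6) by (auto simp: radon_measure_def)
  have sf: "sigma_finite_measure \<mu>"
    using atlas assms(6) by (rule smooth_atlas_sigma_finite)
  note L2 = B_bs_subset_L2[OF sf sets fin]
  have L2_frac: "B_bs \<subseteq> L2 (lambda_mu_frac \<alpha> \<mu>)" and L2_lambda: "B_bs \<subseteq> L2 (lambda_mu \<mu>)"
    unfolding lambda_mu_frac_def lambda_mu_def by (rule L2, assumption)+
  have cont: "continuous_on UNIV \<phi>"
    using assms(12) by (intro smooth_function_continuous[OF atlas]) (simp add: test_functions_def)
  then have \<phi>_meas: "\<phi> \<in> borel_measurable borel"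
    by (rule borel_measurable_continuous_onI)
  define L where "L = closure {x. \<phi> x \<noteq> 0}"
  have L: "compact L"
    using assms(12) by (simp add: test_functions_def L_def)
  have \<phi>_L: "x \<in> L" if "\<phi> x \<noteq> 0" for x
    using that closure_subset[of "{x. \<phi> x \<noteq> 0}"] by (auto simp: L_def)
  have "bounded (\<phi> ` L)"
    using L cont continuous_on_subset by (intro compact_imp_bounded compact_continuous_image) auto
  then obtain D where D: "D > 0" "\<And>x. x \<in> L \<Longrightarrow> cmod (\<phi> x) \<le> D"
    by (auto simp: bounded_pos)
  have \<phi>_D: "cmod (\<phi> x) \<le> D" for x
    using D \<phi>_L[of x] by (cases "\<phi> x = 0") auto
  \<comment> \<open>A bounded function with compact support is integrable because \<mu> is finite on
    compact sets.\<close>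
  have \<phi>_int: "integrable \<mu> \<phi>"
  proof (rule integrableI_bounded_set)
    show "L \<in> sets \<mu>"
      using L by (simp add: sets borel_compact)
    show "\<phi> \<in> borel_measurable \<mu>"
      using \<phi>_meas measurable_cong_sets[OF sets refl] by blast
    show "emeasure \<mu> L < \<infinity>"
      by (rule fin) fact
    show "AE x in \<mu>. x \<in> L \<longrightarrow> cmod (\<phi> x) \<le> D" "AE x in \<mu>. x \<notin> L \<longrightarrow> \<phi> x = 0"
      using \<phi>_D \<phi>_L by auto
  qed
  have an_bs: "annihilation \<mu> \<phi> F \<in> B_bs" and cr_bs: "creation \<phi> F \<in> B_bs" if "F \<in> B_bs" for F
    using annihilation_in_B_bs[OF sf sets \<phi>_int that]
      creation_in_B_bs[OF \<phi>_meas L \<phi>_L \<phi>_D that] by simp_all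
  have IG: "I_op \<alpha> G \<in> B_bs"
    using B_bs_mult_card[OF G, of "\<lambda>n. csqrt (mittag_leffler_deriv0 \<alpha> n)"]
    by (simp add: I_op_def mult.commute)
  have G_meas: "G \<in> borel_measurable config_borel"
    using G by (simp add: B_bs_def)
  \<comment> \<open>The common part of both relations: F stands for the operator applied to
    \<open>I_op \<alpha> G\<close>, H for the operator applied to G, and k for the shift of the
    cardinality, n + 1 or n - 1.\<close>
  have conj: "L2_eq (lambda_mu_frac \<alpha> \<mu>) (I_op_inv \<alpha> \<mu> F)
      (\<lambda>\<eta>. csqrt (mittag_leffler_deriv0 \<alpha> (k (card \<eta>)) / mittag_leffler_deriv0 \<alpha> (card \<eta>)) * H \<eta>)"
    if F: "F \<in> B_bs" and H: "H \<in> B_bs"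
      and FH: "\<And>\<eta>. \<eta> \<in> finite_configs \<Longrightarrow> F \<eta> = csqrt (mittag_leffler_deriv0 \<alpha> (k (card \<eta>))) * H \<eta>"
    for F H k
    unfolding L2_eq_def I_op_inv_eq[OF \<open>0 < \<alpha>\<close> L2_frac F]
  proof (intro conjI)
    have "(\<lambda>\<eta>. inverse (csqrt (mittag_leffler_deriv0 \<alpha> (card \<eta>))) * F \<eta>) \<in> B_bs"
      using B_bs_mult_card[OF F, of "\<lambda>n. inverse (csqrt (mittag_leffler_deriv0 \<alpha> n))"] .
    then have "(\<lambda>\<eta>. F \<eta> / csqrt (mittag_leffler_deriv0 \<alpha> (card \<eta>))) \<in> B_bs"
      by (simp add: divide_inverse mult.commute)
    then show "(\<lambda>\<eta>. F \<eta> / csqrt (mittag_leffler_deriv0 \<alpha> (card \<eta>))) \<in> L2 (lambda_mu_frac \<alpha> \<mu>)"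
      using L2_frac by (rule subsetD[rotated])
    show "(\<lambda>\<eta>. csqrt (mittag_leffler_deriv0 \<alpha> (k (card \<eta>)) / mittag_leffler_deriv0 \<alpha> (card \<eta>)) * H \<eta>)
        \<in> L2 (lambda_mu_frac \<alpha> \<mu>)"
      using B_bs_mult_card[OF H, of "\<lambda>n. csqrt (mittag_leffler_deriv0 \<alpha> (k n) / mittag_leffler_deriv0 \<alpha> n)"]
        L2_frac by blast
    show "AE \<eta> in lambda_mu_frac \<alpha> \<mu>. F \<eta> / csqrt (mittag_leffler_deriv0 \<alpha> (card \<eta>)) =
        csqrt (mittag_leffler_deriv0 \<alpha> (k (card \<eta>)) / mittag_leffler_deriv0 \<alpha> (card \<eta>)) * H \<eta>"
      by (rule AE_I2) (simp add: lambda_mu_frac_def space_weighted_config_measure FH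
          csqrt_mittag_leffler_deriv0_divide[OF \<open>0 < \<alpha>\<close>])
  qed
  have an: "L2_eq (lambda_mu_frac \<alpha> \<mu>) (annihilation_frac \<alpha> \<mu> \<phi> G)
      (\<lambda>\<eta>. csqrt (mittag_leffler_deriv0 \<alpha> (card \<eta> + 1) / mittag_leffler_deriv0 \<alpha> (card \<eta>)) *
        annihilation \<mu> \<phi> G \<eta>)"
    unfolding annihilation_frac_def comp_apply
    using annihilation_I_op[OF sets non_atomic_singleton[OF assms(7) sets] \<phi>_meas G_meas]
    by (intro conj[of _ _ "\<lambda>n. n + 1"] an_bs IG G)
  have cr: "L2_eq (lambda_mu_frac \<alpha> \<mu>) (creation_frac \<alpha> \<mu> \<phi> G)
      (\<lambda>\<eta>. csqrt (mittag_leffler_deriv0 \<alpha> (card \<eta> - 1) / mittag_leffler_deriv0 \<alpha> (card \<eta>)) *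
        creation \<phi> G \<eta>)"
    unfolding creation_frac_def comp_apply
    by (intro conj[of _ _ "\<lambda>n. n - 1"] cr_bs IG G creation_I_op)
  show "I_op \<alpha> G \<in> B_bs \<and>
      annihilation \<mu> \<phi> (I_op \<alpha> G) \<in> L2 (lambda_mu \<mu>) \<and>
      creation \<phi> (I_op \<alpha> G) \<in> L2 (lambda_mu \<mu>) \<and>
      L2_eq (lambda_mu_frac \<alpha> \<mu>)
        (annihilation_frac \<alpha> \<mu> \<phi> G)
        (\<lambda>\<eta>. csqrt (mittag_leffler_deriv0 \<alpha> (card \<eta> + 1) / mittag_leffler_deriv0 \<alpha> (card \<eta>)) * annihilation \<mu> \<phi> G \<eta>) \<and>
      L2_eq (lambda_mu_frac \<alpha> \<mu>)
        (creation_frac \<alpha> \<mu> \<phi> G)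
        (\<lambda>\<eta>. csqrt (mittag_leffler_deriv0 \<alpha> (card \<eta> - 1) / mittag_leffler_deriv0 \<alpha> (card \<eta>)) * creation \<phi> G \<eta>)"
    using IG an_bs[OF IG] cr_bs[OF IG] L2_lambda an cr by blast
qed

end
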